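(* Let $k\ge 0$ be an integer and let $G=(V,E)$ be a finite connected simple graph with treewidth $\operatorname{tw}(G)\le k$. Then for every real $\beta>0$ satisfying $$\beta>\frac{k-1}{2},$$ the function $x\mapsto T_G(x)^{-\beta}$ is completely monotone on $(0,\infty)^E$.
   Context: For a finite connected graph $G=(V,E)$, the spanning-tree polynomial is $T_G(x)=\sum_{T\in\mathcal{T}(G)}\prod_{e\in T}x_e$, $x=(x_e)_{e\in E}$, where $\mathcal{T}(G)$ is the set of spanning trees of $G$ (each identified with its edge set). A function $f\in C^\infty((0,\infty)^n)$ is completely monotone if $(-1)^{|\alpha|}\partial^\alpha f(x)\ge 0$ for all multi-indices $\alpha\in\mathbb{N}^n$ (including $\alpha=0$) and all $x\in(0,\infty)^n$. The treewidth of $G$ is the standard graph parameter; equivalently, $\operatorname{tw}(G)\le k$ iff $G$ is a spanning subgraph of a chordal graph on the same vertex set whose clique number is at most $k+1$. *)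

theory Defs
  imports "HOL-Analysis.Analysis"
begin

section \<open>Finite simple graphs, trees and spanning trees\<close>

definition simple_graph :: "'a set \<Rightarrow> 'a set set \<Rightarrow> bool" where
  "simple_graph V E \<longleftrightarrow> finite V \<and> (\<forall>e\<in>E. e \<subseteq> V \<and> card e = 2)"

(* The graph without vertices does not count as connected. *)
definition connected_graph :: "'a set \<Rightarrow> 'a set set \<Rightarrow> bool" where
  "connected_graph V E \<longleftrightarrow>
     simple_graph V E \<and> V \<noteq> {} \<and> (\<forall>u\<in>V. \<forall>v\<in>V. (u, v) \<in> {(x, y). {x, y} \<in> E}\<^sup>*)"

(* A cycle is given by the list of its vertices, each listed once. *)
definition graph_cycle :: "'a set set \<Rightarrow> 'a list \<Rightarrow> bool" where
  "graph_cycle E p \<longleftrightarrow>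
     3 \<le> length p \<and> distinct p \<and>
     (\<forall>i<length p. {p ! i, p ! (Suc i mod length p)} \<in> E)"

definition tree_graph :: "'a set \<Rightarrow> 'a set set \<Rightarrow> bool" where
  "tree_graph V E \<longleftrightarrow> connected_graph V E \<and> (\<nexists>p. graph_cycle E p)"

definition spanning_trees :: "'a set \<Rightarrow> 'a set set \<Rightarrow> 'a set set set" where
  "spanning_trees V E = {T. T \<subseteq> E \<and> tree_graph V T}"

definition spanning_tree_poly :: "'a set \<Rightarrow> 'a set set \<Rightarrow> ('a set \<Rightarrow> real) \<Rightarrow> real" where
  "spanning_tree_poly V E x = (\<Sum>T\<in>spanning_trees V E. \<Prod>e\<in>T. x e)"


section \<open>Treewidth\<close>

definition tree_decomposition ::
    "'a set \<Rightarrow> 'a set set \<Rightarrow> 'i set \<Rightarrow> 'i set set \<Rightarrow> ('i \<Rightarrow> 'a set) \<Rightarrow> bool" where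
  "tree_decomposition V E I F B \<longleftrightarrow>
     tree_graph I F \<and>
     (\<Union>i\<in>I. B i) = V \<and>
     (\<forall>e\<in>E. \<exists>i\<in>I. e \<subseteq> B i) \<and>
     (\<forall>v\<in>V. connected_graph {i\<in>I. v \<in> B i} {f\<in>F. f \<subseteq> {i\<in>I. v \<in> B i}})"

definition decomposition_width :: "'i set \<Rightarrow> ('i \<Rightarrow> 'a set) \<Rightarrow> nat" where
  "decomposition_width I B = Max ((\<lambda>i. card (B i)) ` I) - 1"

(* Every finite tree is isomorphic to one whose nodes are natural numbers, so restricting
   the decomposition trees to nodes of type nat loses no widths. The truncated subtraction
   in the width differs from the usual convention only for the graph without vertices. *)
definition treewidth :: "'a set \<Rightarrow> 'a set set \<Rightarrow> nat" where
  "treewidth V E =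
     (LEAST w. \<exists>(I :: nat set) F B. tree_decomposition V E I F B \<and> decomposition_width I B = w)"


section \<open>Complete monotonicity on the open orthant\<close>

(* Points of R^E are the extensional functions on E (value undefined outside E), with the
   subspace topology of the product topology; thus E may be empty. *)
definition positive_orthant :: "'e set \<Rightarrow> ('e \<Rightarrow> real) set" where
  "positive_orthant E = (E \<rightarrow>\<^sub>E {0<..})"

definition partial_deriv :: "'e \<Rightarrow> (('e \<Rightarrow> real) \<Rightarrow> real) \<Rightarrow> ('e \<Rightarrow> real) \<Rightarrow> real" where
  "partial_deriv e f x = deriv (\<lambda>t. f (x(e := t))) (x e)"

primrec iterated_partial :: "'e list \<Rightarrow> (('e \<Rightarrow> real) \<Rightarrow> real) \<Rightarrow> ('e \<Rightarrow> real) \<Rightarrow> real" where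
  "iterated_partial [] f = f"
| "iterated_partial (e # es) f = partial_deriv e (iterated_partial es f)"

(* C-infinity: all iterated partial derivatives, in every order of differentiation, exist
   and are continuous. *)
definition smooth_on_orthant :: "'e set \<Rightarrow> (('e \<Rightarrow> real) \<Rightarrow> real) \<Rightarrow> bool" where
  "smooth_on_orthant E f \<longleftrightarrow>
     (\<forall>es\<in>lists E.
        continuous_on (positive_orthant E) (iterated_partial es f) \<and>
        (\<forall>e\<in>E. \<forall>x\<in>positive_orthant E.
           (\<lambda>t. iterated_partial es f (x(e := t))) differentiable at (x e)))"

(* A list es over E enumerates the multi-index alpha with alpha(e) the number of occurrences
   of e in es, so that |alpha| = length es. For smooth f the derivative depends only on alpha
   (Schwarz), and every alpha arises. *)
definition completely_monotone :: "'e set \<Rightarrow> (('e \<Rightarrow> real) \<Rightarrow> real) \<Rightarrow> bool" where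
  "completely_monotone E f \<longleftrightarrow>
     smooth_on_orthant E f \<and>
     (\<forall>es\<in>lists E. \<forall>x\<in>positive_orthant E. 0 \<le> (-1) ^ length es * iterated_partial es f x)"

end

theory Submission
  imports Defs "HOL-Probability.Distributions"
begin

text \<open>A vertex \<open>v\<close> contained, together with its set \<open>N\<close> of neighbours, in one bag of a tree decomposition
  is eliminated by the star-mesh transform: \<open>T\<^bsub>G\<^esub>(x) = s * T\<^bsub>G'\<^esub>(x')\<close>, where \<open>s\<close> is the total weight at \<open>v\<close>,
  \<open>N\<close> becomes a clique of \<open>G'\<close>, and \<open>x'\<close> adds \<open>x(uv) * x(wv) / s\<close> to the weight of \<open>uw\<close>. By induction,
  \<open>T\<^bsub>G\<^esub>\<close> to the power \<open>- \<beta>\<close> is a mixture of exponentials \<open>exp (- (\<Sum>e. a e * x e))\<close> where, on every clique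
  of \<open>G\<close>, \<open>a\<close> is the matrix of squared distances of points in a Euclidean space. Indeed, the at most \<open>k\<close>
  points of \<open>N\<close> lie in dimension \<open>d = card N - 1 \<le> k - 1\<close>. A Gaussian integral over the position of \<open>v\<close> in that
  space turns \<open>exp (- (\<Sum>u. x(uv) * |q u - p|\<^sup>2))\<close> into the star-mesh correction times \<open>s\<close> to the power
  \<open>- d / 2\<close>, and a Gamma integral over its squared height above the space supplies the remaining positive
  exponent \<open>\<beta> - d / 2\<close>. Complete monotonicity is read off from the signs of mixed differences, which survive
  integration.\<close>

section \<open>Parent maps\<close>

text \<open>The star-mesh identity is proved for weights \<open>w u z\<close> that need not be
  symmetric. A sum over undirected trees leaves no room for the intermediate stages of an
  elimination; in a sum over parent maps each vertex owns a row that can be changed alone, as in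
  Gaussian elimination on a Laplacian. The bound on \<open>\<beta>\<close> is a matter of dimension.
  The height given to a restored vertex adds a coordinate, hence the dimension is cut back to one
  less than the number of points, by Gram-Schmidt, each time before integrating. Squared distances
  are demanded on cliques only, because this condition can be carried from the smaller graph to the
  larger: the neighbours of \<open>v\<close> form a clique of the smaller graph, so they already
  have positions, and every clique through \<open>v\<close> consists of \<open>v\<close> and some of
  them.\<close>

inductive reaches :: "('a \<Rightarrow> 'a) \<Rightarrow> 'a \<Rightarrow> 'a \<Rightarrow> bool" for f r where
  root: "reaches f r r"
| step: "reaches f r (f u) \<Longrightarrow> reaches f r u"

lemma reaches_step_iff: "u \<noteq> r \<Longrightarrow> reaches f r u \<longleftrightarrow> reaches f r (f u)"
  by (rule iffI, erule reaches.cases, simp, simp, erule reaches.step)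

definition rooted :: "'a set \<Rightarrow> 'a \<Rightarrow> ('a \<Rightarrow> 'a) \<Rightarrow> bool" where
  "rooted W r f \<longleftrightarrow> (\<forall>u\<in>W. reaches f r u)"

text \<open>By the matrix-tree theorem this is the determinant of the reduced Laplacian with
  off-diagonal entries \<open>- w u z\<close>, the row and column of \<open>r\<close>
  deleted.\<close>

definition arbo :: "'a set \<Rightarrow> 'a \<Rightarrow> ('a \<Rightarrow> 'a \<Rightarrow> real) \<Rightarrow> real" where
  "arbo W r w = (\<Sum>f\<in>W \<rightarrow>\<^sub>E insert r W. of_bool (rooted W r f) * (\<Prod>u\<in>W. w u (f u)))"

text \<open>The rank is the number of steps to \<open>r\<close>. Its strict decrease is what later
  excludes fixed points, shared edges and cycles.\<close>

lemma reaches_rank: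
  assumes "rooted W r f" "r \<notin> W"
  obtains d :: "'a \<Rightarrow> nat" where "\<And>u. u \<in> W \<Longrightarrow> d (f u) < d u"
proof -
  have ex: "\<exists>n. (f ^^ n) u = r" if "reaches f r u" for u
    using that
  proof induction
    case root
    then show ?case by (intro exI[of _ 0]) simp
  next
    case (step u)
    then obtain n where "(f ^^ n) (f u) = r" by blast
    then show ?case by (intro exI[of _ "Suc n"]) (simp add: funpow_swap1)
  qed
  define d where "d u = (LEAST n. (f ^^ n) u = r)" for u
  have "d (f u) < d u" if u: "u \<in> W" for u
  proof -
    have *: "(f ^^ d u) u = r"
      unfolding d_def by (rule LeastI_ex) (use assms(1) u ex in \<open>auto simp: rooted_def\<close>)
    have "d u \<noteq> 0"
    proof
      assume "d u = 0"
      with * have "u = r" by simp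
      with u assms(2) show False by simp
    qed
    then obtain n where n: "d u = Suc n" using not0_implies_Suc by blast
    with * have "(f ^^ n) (f u) = r" by (simp add: funpow_swap1)
    then have "d (f u) \<le> n" unfolding d_def by (rule Least_le)
    with n show ?thesis by simp
  qed
  then show thesis by (rule that)
qed

lemma reaches_closed:
  assumes "\<And>x. x \<in> C \<Longrightarrow> f x \<in> C" "r \<notin> C" "u \<in> C"
  shows "\<not> reaches f r u"
proof
  assume "reaches f r u"
  then have "u \<notin> C" by induction (use assms in auto)
  with assms show False by blast
qed

lemma rootedI_rank:
  assumes "\<And>u. u \<in> W \<Longrightarrow> f u \<in> insert r W" and "\<And>u. u \<in> W \<Longrightarrow> d (f u) < (d u :: nat)"
  shows "rooted W r f"
proof -
  have "reaches f r u" if "u \<in> insert r W" for u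
    using that
  proof (induction "d u" arbitrary: u rule: less_induct)
    case less
    then show ?case using assms
      by (cases "u = r") (auto intro: reaches.root reaches.step)
  qed
  then show ?thesis by (simp add: rooted_def)
qed

text \<open>With the parents of \<open>u\<close> and \<open>v\<close> left open, every other vertex leads to one of the blocks of
  \<open>u\<close>, \<open>v\<close> and \<open>r\<close>; which choices of the two parents give a rooted map depends only on the blocks
  in which they lie.\<close>

lemma rooted_swap_identity:
  assumes uv: "u \<noteq> v" "u \<in> W" "v \<in> W" "r \<notin> W"
    and y: "y \<in> insert r W" and z: "z \<in> insert r W"
    and fW: "\<And>x. x \<in> W - {u, v} \<Longrightarrow> f x \<in> insert r W"
  shows "of_bool (rooted W r (f(u := v, v := z))) + of_bool (rooted W r (f(u := v, v := y))) =
    (of_bool (rooted W r (f(u := y, v := z))) + of_bool (rooted W r (f(u := z, v := y))) :: real)"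
proof -
  \<comment> \<open>Making \<open>u\<close>, \<open>v\<close> and \<open>r\<close> fixed points ends
    every walk of \<open>f\<close> at the first of them that it meets; \<open>blk t x\<close> says
    that the walk from \<open>x\<close> ends at \<open>t\<close>.\<close>
  define stop where "stop = (\<lambda>x. if x = u \<or> x = v \<or> x = r then x else f x)"
  define blk where "blk t x \<longleftrightarrow> reaches stop t x" for t x
  have blk_self: "blk t t" for t by (simp add: blk_def reaches.root)
  have ur: "u \<noteq> r" "v \<noteq> r" using uv by auto
  have disj: "s = t" if "blk s x" "blk t x" "s \<in> {u, v, r}" "t \<in> {u, v, r}" for s t x
    using that unfolding blk_def
  proof (induction rule: reaches.induct)
    case root
    then show ?case
      using reaches_closed[of "{s}" stop t s] by (auto simp: stop_def)
  next
    case (step x)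
    have "reaches stop t (stop x)"
      using step.prems step.hyps
      by (cases "x = t") (auto simp: reaches_step_iff stop_def intro: reaches.root)
    with step show ?case by auto
  qed
  have blk_t: "blk t x \<Longrightarrow> t \<in> {u, v, r} \<Longrightarrow> reaches g r t \<Longrightarrow>
      (\<And>x. x \<notin> {u, v, r} \<Longrightarrow> g x = f x) \<Longrightarrow> reaches g r x" for t x g
    unfolding blk_def
  proof (induction rule: reaches.induct)
    case (step x)
    then have "reaches g r (stop x)" by blast
    then show ?case using step.prems(3)[of x] step.hyps(1)
      by (cases "x \<in> {u, v, r}") (auto simp: stop_def intro: reaches.step)
  qed
  have blk_f: "blk t x \<Longrightarrow> t \<in> {u, v, r} \<Longrightarrow> reaches g r x \<Longrightarrow>
      (\<And>x. x \<notin> {u, v, r} \<Longrightarrow> g x = f x) \<Longrightarrow> reaches g r t" for t x g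
    unfolding blk_def
  proof (induction rule: reaches.induct)
    case (step x)
    then have "reaches g r (stop x)"
      by (cases "x \<in> {u, v, r}") (auto simp: stop_def reaches_step_iff)
    then show ?case using step by blast
  qed
  have cover: "\<exists>t\<in>{u, v, r}. blk t x"
    if "reaches g r x" "\<And>x. x \<notin> {u, v, r} \<Longrightarrow> g x = f x" for g x
    using that(1)
  proof (induction rule: reaches.induct)
    case root
    then show ?case by (auto simp: blk_def intro: reaches.root)
  next
    case (step x)
    then show ?case using that(2)[of x]
      by (cases "x \<in> {u, v, r}") (auto simp: blk_def stop_def intro: reaches.root reaches.step)
  qed
  show ?thesis
  proof (cases "\<forall>x\<in>insert r W. \<exists>t\<in>{u, v, r}. blk t x")
    \<comment> \<open>Some vertex never meets \<open>u\<close>, \<open>v\<close> or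
      \<open>r\<close>, so it does not reach \<open>r\<close> whatever the two parents are, and all
      four terms are 0.\<close>
    case False
    then have "\<not> rooted W r (f(u := a, v := b))" for a b
    proof -
      obtain x where x: "x \<in> insert r W" "\<not> (\<exists>t\<in>{u, v, r}. blk t x)" using False by blast
      have "\<not> reaches (f(u := a, v := b)) r x" using cover[of "f(u := a, v := b)" x] x by auto
      then show ?thesis using x(1) by (auto simp: rooted_def intro: reaches.root)
    qed
    then show ?thesis by simp
  next
    case True
    \<comment> \<open>The acyclic patterns: both parents in the block of \<open>r\<close>, or one of
      \<open>u\<close>, \<open>v\<close> hanging there and the other one in the block of the
      first.\<close>
    have char: "rooted W r (f(u := a, v := b)) \<longleftrightarrow>
        blk r a \<and> blk r b \<or> blk r a \<and> blk u b \<or> blk v a \<and> blk r b"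
      if a: "a \<in> insert r W" and b: "b \<in> insert r W" for a b
    proof -
      let ?g = "f(u := a, v := b)"
      have g: "?g x = f x" if "x \<notin> {u, v, r}" for x using that by auto
      have su: "reaches ?g r u \<longleftrightarrow> reaches ?g r a" using reaches_step_iff[of u r ?g] ur uv by simp
      have sv: "reaches ?g r v \<longleftrightarrow> reaches ?g r b" using reaches_step_iff[of v r ?g] ur uv by simp
      have R: "blk t x \<Longrightarrow> t \<in> {u, v, r} \<Longrightarrow> reaches ?g r x \<longleftrightarrow> reaches ?g r t" for t x
        using blk_t blk_f g by blast
      have rr: "reaches ?g r r" by (rule reaches.root)
      have rt: "rooted W r ?g \<longleftrightarrow> reaches ?g r u \<and> reaches ?g r v"
        unfolding rooted_def using True R uv rr by (metis insertCI insertE singletonD)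
      obtain s where s: "s \<in> {u, v, r}" "blk s a" using True a by blast
      obtain t where t: "t \<in> {u, v, r}" "blk t b" using True b by blast
      \<comment> \<open>\<open>s\<close> and \<open>t\<close> are the blocks of the parents
        \<open>a\<close> of \<open>u\<close> and \<open>b\<close> of \<open>v\<close>. If
        \<open>S\<close> is closed under passing from a vertex to the block of its parent, the union
        of its blocks is invariant under the map and misses \<open>r\<close>.\<close>
      have trap: "\<not> reaches ?g r x"
        if S: "S \<subseteq> {u, v}" "u \<in> S \<Longrightarrow> s \<in> S" "v \<in> S \<Longrightarrow> t \<in> S" "x \<in> S" for S x
      proof (rule reaches_closed[where C = "{x. \<exists>t\<in>S. blk t x}"])
        fix x assume "x \<in> {x. \<exists>t\<in>S. blk t x}"
        then obtain p where p: "p \<in> S" "blk p x" by blast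
        show "?g x \<in> {x. \<exists>t\<in>S. blk t x}"
        proof (cases "x \<in> {u, v, r}")
          case True
          with p S(1) have "p = x" by (metis blk_self disj subsetD insertCI insertE singletonD)
          then show ?thesis using p S(1-3) s t uv ur by auto
        next
          case False
          have "x \<noteq> p" using False p(1) S(1) by auto
          then have "blk p (f x)" using p(2) False unfolding blk_def
            by (simp add: reaches_step_iff stop_def)
          then show ?thesis using False p(1) by auto
        qed
      next
        show "r \<notin> {x. \<exists>t\<in>S. blk t x}" using S(1) ur disj blk_self by fastforce
        show "x \<in> {x. \<exists>t\<in>S. blk t x}" using S(4) blk_self by blast
      qed
      have ra: "reaches ?g r a \<longleftrightarrow> reaches ?g r s" using R s by blast
      have rb: "reaches ?g r b \<longleftrightarrow> reaches ?g r t" using R t by blast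
      have D: "blk p a \<longleftrightarrow> p = s" "blk p b \<longleftrightarrow> p = t" if "p \<in> {u, v, r}" for p
        using disj s t that by blast+
      have n1: "s = u \<Longrightarrow> \<not> reaches ?g r u" by (rule trap[of "{u}"]) (use uv(1) in auto)
      have n2: "t = v \<Longrightarrow> \<not> reaches ?g r v" by (rule trap[of "{v}"]) (use uv(1) in auto)
      have n3: "s = v \<Longrightarrow> t = u \<Longrightarrow> \<not> reaches ?g r u" by (rule trap[of "{u, v}"]) (use uv(1) in auto)
      have p1: "s = r \<Longrightarrow> reaches ?g r u" and p2: "t = r \<Longrightarrow> reaches ?g r v"
        using su sv ra rb rr by simp_all
      have p3: "s = r \<Longrightarrow> t = u \<Longrightarrow> reaches ?g r v" and p4: "s = v \<Longrightarrow> t = r \<Longrightarrow> reaches ?g r u"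
        using su sv ra rb p1 p2 by blast+
      have "reaches ?g r u \<and> reaches ?g r v \<longleftrightarrow>
          s = r \<and> t = r \<or> s = r \<and> t = u \<or> s = v \<and> t = r"
        using s(1) t(1) n1 n2 n3 p1 p2 p3 p4 by blast
      then show ?thesis using rt D by blast
    qed
    obtain s where s: "s \<in> {u, v, r}" "blk s y" using True y by blast
    obtain t where t: "t \<in> {u, v, r}" "blk t z" using True z by blast
    have D: "blk p y \<longleftrightarrow> p = s" "blk p z \<longleftrightarrow> p = t" "blk p v \<longleftrightarrow> p = v" if "p \<in> {u, v, r}" for p
      using disj s t that blk_self by blast+
    have mem: "u \<in> {u, v, r}" "v \<in> {u, v, r}" "r \<in> {u, v, r}" by auto
    have vW: "v \<in> insert r W" using uv by simp
    note Du = D[OF mem(1)] and Dv = D[OF mem(2)] and Dr = D[OF mem(3)]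
    have nes: "u \<noteq> v" "v \<noteq> u" "u \<noteq> r" "r \<noteq> u" "v \<noteq> r" "r \<noteq> v" using ur uv by auto
    \<comment> \<open>Now \<open>s\<close> and \<open>t\<close> are the blocks of \<open>y\<close>
      and \<open>z\<close>. As \<open>v\<close> lies in its own block, the left side counts how many
      of \<open>y\<close>, \<open>z\<close> lie in the block of \<open>r\<close>; the nine cases of
      \<open>(s, t)\<close> confirm the same for the right side.\<close>
    show ?thesis
      unfolding char[OF vW z] char[OF vW y] char[OF y z] char[OF z y] Du Dv Dr
      using s(1) t(1) by (elim insertE emptyE) (simp_all add: nes)
  qed
qed

section \<open>Row operations on \<open>arbo\<close> and elimination of a vertex\<close>

lemma sum_PiE_insert:
  assumes "x \<notin> S"
  shows "(\<Sum>f\<in>insert x S \<rightarrow>\<^sub>E T. h f) = (\<Sum>y\<in>T. \<Sum>g\<in>S \<rightarrow>\<^sub>E T. h (g(x := y)))"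
proof -
  have "(\<Sum>f\<in>insert x S \<rightarrow>\<^sub>E T. h f) = (\<Sum>(y, g)\<in>T \<times> (S \<rightarrow>\<^sub>E T). h (g(x := y)))"
    unfolding PiE_insert_eq
    by (subst sum.reindex[OF inj_combinator[OF assms]]) (simp add: case_prod_unfold)
  then show ?thesis by (simp add: sum.cartesian_product)
qed

text \<open>A rooted map has no fixed point, so the diagonal of the weights is never read. The
  star-mesh correction creates loops, which are discarded in this way.\<close>

lemma arbo_cong:
  assumes "\<And>u z. u \<in> W \<Longrightarrow> z \<in> insert r W \<Longrightarrow> u \<noteq> z \<Longrightarrow> w u z = w' u z" "r \<notin> W"
  shows "arbo W r w = arbo W r w'"
  unfolding arbo_def
proof (intro sum.cong refl)
  fix f assume f: "f \<in> W \<rightarrow>\<^sub>E insert r W"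
  show "of_bool (rooted W r f) * (\<Prod>u\<in>W. w u (f u)) = of_bool (rooted W r f) * (\<Prod>u\<in>W. w' u (f u))"
  proof (cases "rooted W r f")
    case True
    then obtain d :: "'a \<Rightarrow> nat" where "\<And>u. u \<in> W \<Longrightarrow> d (f u) < d u"
      using reaches_rank[OF True assms(2)] by blast
    then have "u \<in> W \<Longrightarrow> u \<noteq> f u" for u by (metis less_irrefl)
    then have "(\<Prod>u\<in>W. w u (f u)) = (\<Prod>u\<in>W. w' u (f u))"
      using f by (intro prod.cong refl assms) auto
    then show ?thesis by simp
  qed simp
qed

lemma arbo_row_linear:
  assumes "u \<in> W" "finite W"
  shows "arbo W r (w(u := \<lambda>z. p z + c * q z)) = arbo W r (w(u := p)) + c * arbo W r (w(u := q))"
proof -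
  have "(\<Prod>x\<in>W. (w(u := a)) x (f x)) = a (f u) * (\<Prod>x\<in>W - {u}. w x (f x))" for a f
    using assms by (subst prod.remove[of _ u]) (auto intro: prod.cong)
  then show ?thesis unfolding arbo_def
    by (simp add: algebra_simps sum.distrib sum_distrib_left)
qed

text \<open>In the Laplacian, subtracting row \<open>v\<close> from a row \<open>u\<close> with
  equal weights leaves the row sum times the row of a vertex whose only parent is \<open>v\<close>.
  Here the swap identity does this, averaged over the parents \<open>y\<close>, \<open>z\<close>
  with the symmetric weight \<open>w v y * w v z\<close>.\<close>

lemma arbo_row_reduce:
  assumes uv: "u \<noteq> v" "u \<in> W" "v \<in> W" "r \<notin> W" and fin: "finite W"
  shows "arbo W r (w(u := w v)) =
    (\<Sum>z\<in>insert r W. w v z) * arbo W r (w(u := \<lambda>z. of_bool (z = v)))"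
proof -
  let ?R = "insert r W"
  let ?q = "w v"
  let ?S = "W - {u, v}"
  define c where "c y z = (\<Sum>g\<in>?S \<rightarrow>\<^sub>E ?R. of_bool (rooted W r (g(u := y, v := z))) * (\<Prod>x\<in>?S. w x (g x)))"
    for y z
  have W: "W = insert v (insert u ?S)" using uv by auto
  have expand: "arbo W r (w(u := a)) = (\<Sum>z\<in>?R. \<Sum>y\<in>?R. a y * ?q z * c y z)" for a
  proof -
    have "arbo W r (w(u := a)) = (\<Sum>f\<in>insert v (insert u ?S) \<rightarrow>\<^sub>E ?R.
        of_bool (rooted W r f) * (\<Prod>x\<in>W. (w(u := a)) x (f x)))"
      using W by (simp add: arbo_def)
    also have "\<dots> = (\<Sum>z\<in>?R. \<Sum>y\<in>?R. \<Sum>g\<in>?S \<rightarrow>\<^sub>E ?R.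
        of_bool (rooted W r (g(u := y, v := z))) *
        (\<Prod>x\<in>W. (w(u := a)) x ((g(u := y, v := z)) x)))"
      using uv by (subst sum_PiE_insert, simp, subst sum_PiE_insert, simp_all)
    also have "\<dots> = (\<Sum>z\<in>?R. \<Sum>y\<in>?R. \<Sum>g\<in>?S \<rightarrow>\<^sub>E ?R.
        of_bool (rooted W r (g(u := y, v := z))) * (a y * ?q z * (\<Prod>x\<in>?S. w x (g x))))"
    proof (intro sum.cong refl arg_cong2[where f = "(*)"])
      fix z y g
      have "(\<Prod>x\<in>W. (w(u := a)) x ((g(u := y, v := z)) x)) =
         (\<Prod>x\<in>insert v (insert u ?S). (w(u := a)) x ((g(u := y, v := z)) x))"
        using W by simp
      also have "\<dots> = ?q z * (a y * (\<Prod>x\<in>?S. (w(u := a)) x ((g(u := y, v := z)) x)))"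
        using uv fin by simp
      also have "(\<Prod>x\<in>?S. (w(u := a)) x ((g(u := y, v := z)) x)) = (\<Prod>x\<in>?S. w x (g x))"
        by (intro prod.cong) auto
      finally show "(\<Prod>x\<in>W. (w(u := a)) x ((g(u := y, v := z)) x)) =
        a y * ?q z * (\<Prod>x\<in>?S. w x (g x))" by (simp only: mult_ac)
    qed
    finally show ?thesis unfolding c_def
      by (simp add: sum_distrib_left mult_ac)
  qed
  have sym: "c v z + c v y = c y z + c z y" if "y \<in> ?R" "z \<in> ?R" for y z
    unfolding c_def sum.distrib[symmetric] distrib_right[symmetric]
    using that by (intro sum.cong refl arg_cong2[where f = "(*)"] rooted_swap_identity uv) auto
  have finR: "finite ?R" using fin by simp
  let ?A = "\<Sum>z\<in>?R. \<Sum>y\<in>?R. ?q y * ?q z * c y z"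
  \<comment> \<open>Exchanging \<open>y\<close> and \<open>z\<close> in one of two copies
    symmetrizes \<open>c\<close>, as the swap identity requires.\<close>
  have "2 * ?A = ?A + (\<Sum>z\<in>?R. \<Sum>y\<in>?R. ?q y * ?q z * c z y)"
    by (subst (3) sum.swap) (simp add: mult_ac)
  also have "\<dots> = (\<Sum>z\<in>?R. \<Sum>y\<in>?R. ?q y * ?q z * (c y z + c z y))"
    by (simp add: sum.distrib algebra_simps)
  also have "\<dots> = (\<Sum>z\<in>?R. \<Sum>y\<in>?R. ?q y * ?q z * (c v z + c v y))"
    by (intro sum.cong refl) (simp add: sym)
  also have "\<dots> = (\<Sum>z\<in>?R. \<Sum>y\<in>?R. ?q y * (?q z * c v z)) + (\<Sum>z\<in>?R. \<Sum>y\<in>?R. ?q z * (?q y * c v y))"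
    by (simp add: sum.distrib algebra_simps)
  also have "\<dots> = 2 * ((\<Sum>y\<in>?R. ?q y) * (\<Sum>z\<in>?R. ?q z * c v z))"
    by (simp add: sum_distrib_left[symmetric] sum_distrib_right[symmetric])
  finally have *: "?A = (\<Sum>y\<in>?R. ?q y) * (\<Sum>z\<in>?R. ?q z * c v z)" by simp
  have "(\<Sum>y\<in>?R. of_bool (y = v) * ?q z * c y z) = ?q z * c v z" for z
  proof -
    have "(\<Sum>y\<in>?R. of_bool (y = v) * ?q z * c y z) = (\<Sum>y\<in>?R. if y = v then ?q z * c v z else 0)"
      by (intro sum.cong) auto
    then show ?thesis using finR uv by simp
  qed
  then show ?thesis using * expand[of ?q] expand[of "\<lambda>z. of_bool (z = v)"] by simp
qed

text \<open>A map that makes \<open>v\<close> a parent has weight 0, so \<open>v\<close> hangs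
  freely from any other vertex and the rest is a rooted map on \<open>W - {v}\<close>. The summand
  for \<open>z = v\<close> is 0 as well.\<close>

lemma arbo_leaf:
  assumes v: "v \<in> W" "r \<notin> W" and fin: "finite W"
    and leaf: "\<And>u. u \<in> W \<Longrightarrow> w u v = 0"
  shows "arbo W r w = (\<Sum>z\<in>insert r W. w v z) * arbo (W - {v}) r w"
proof -
  let ?S = "W - {v}" and ?R = "insert r W"
  have W: "W = insert v ?S" using v by auto
  have "arbo W r w = (\<Sum>f\<in>insert v ?S \<rightarrow>\<^sub>E ?R. of_bool (rooted W r f) * (\<Prod>x\<in>W. w x (f x)))"
    using W by (simp add: arbo_def)
  also have "\<dots> = (\<Sum>y\<in>?R. \<Sum>g\<in>?S \<rightarrow>\<^sub>E ?R.
      of_bool (rooted W r (g(v := y))) * (\<Prod>x\<in>W. w x ((g(v := y)) x)))"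
    by (subst sum_PiE_insert) simp_all
  also have "\<dots> = (\<Sum>y\<in>?R. \<Sum>g\<in>?S \<rightarrow>\<^sub>E ?R.
      w v y * (of_bool (rooted W r (g(v := y))) * (\<Prod>x\<in>?S. w x (g x))))"
  proof (intro sum.cong refl)
    fix g y
    have "(\<Prod>x\<in>W. w x ((g(v := y)) x)) = w v y * (\<Prod>x\<in>?S. w x ((g(v := y)) x))"
      using prod.remove[OF fin v(1), of "\<lambda>x. w x ((g(v := y)) x)"] by simp
    also have "(\<Prod>x\<in>?S. w x ((g(v := y)) x)) = (\<Prod>x\<in>?S. w x (g x))"
      by (intro prod.cong) auto
    finally show "of_bool (rooted W r (g(v := y))) * (\<Prod>x\<in>W. w x ((g(v := y)) x)) =
        w v y * (of_bool (rooted W r (g(v := y))) * (\<Prod>x\<in>?S. w x (g x)))" by simp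
  qed
  also have "\<dots> = (\<Sum>y\<in>?R. w v y * (\<Sum>g\<in>?S \<rightarrow>\<^sub>E insert r ?S.
      of_bool (rooted ?S r g) * (\<Prod>x\<in>?S. w x (g x))))"
  proof (intro sum.cong refl)
    fix y assume y: "y \<in> ?R"
    show "(\<Sum>g\<in>?S \<rightarrow>\<^sub>E ?R. w v y * (of_bool (rooted W r (g(v := y))) * (\<Prod>x\<in>?S. w x (g x)))) =
      w v y * (\<Sum>g\<in>?S \<rightarrow>\<^sub>E insert r ?S. of_bool (rooted ?S r g) * (\<Prod>x\<in>?S. w x (g x)))"
    proof (cases "y = v")
      case True
      then show ?thesis using leaf v by simp
    next
      case False
      have sub: "?S \<rightarrow>\<^sub>E insert r ?S \<subseteq> ?S \<rightarrow>\<^sub>E ?R" by (intro PiE_mono) auto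
      have zero: "(\<Prod>x\<in>?S. w x (g x)) = 0" if g: "g \<in> (?S \<rightarrow>\<^sub>E ?R) - (?S \<rightarrow>\<^sub>E insert r ?S)" for g
      proof -
        obtain x where x: "x \<in> ?S" "g x \<notin> insert r ?S" using g by (auto simp: PiE_iff)
        then have "g x = v" using g by (auto simp: PiE_iff)
        then have "w x (g x) = 0" using x leaf by simp
        then show ?thesis using x fin by (intro prod_zero) auto
      qed
      have eq: "rooted W r (g(v := y)) \<longleftrightarrow> rooted ?S r g" if g: "g \<in> ?S \<rightarrow>\<^sub>E insert r ?S" for g
      proof -
        have gv: "x \<in> insert r ?S \<Longrightarrow> reaches (g(v := y)) r x \<longleftrightarrow> reaches g r x" for x
        proof
          assume x: "x \<in> insert r ?S"
          show "reaches (g(v := y)) r x \<Longrightarrow> reaches g r x"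
          proof -
            assume "reaches (g(v := y)) r x"
            then have "x \<in> insert r ?S \<longrightarrow> reaches g r x"
            proof induction
              case (step u)
              then show ?case using g
                by (cases "u = r") (auto simp: PiE_iff intro: reaches.root reaches.step)
            qed (auto intro: reaches.root)
            then show ?thesis using x by blast
          qed
          show "reaches g r x \<Longrightarrow> reaches (g(v := y)) r x"
          proof -
            assume "reaches g r x"
            then have "x \<in> insert r ?S \<longrightarrow> reaches (g(v := y)) r x"
            proof induction
              case (step u)
              then show ?case using g v
                by (cases "u = r") (auto simp: PiE_iff reaches_step_iff intro: reaches.root)
            qed (auto intro: reaches.root)
            then show ?thesis using x by blast
          qed
        qed
        have "v \<noteq> r" using v by auto
        then have "reaches (g(v := y)) r v \<longleftrightarrow> reaches (g(v := y)) r y"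
          by (simp add: reaches_step_iff)
        moreover have "y \<in> insert r ?S" using y False by auto
        ultimately show ?thesis using gv unfolding rooted_def
          by (subst W) (auto intro: reaches.root)
      qed
      have "(\<Sum>g\<in>?S \<rightarrow>\<^sub>E ?R. of_bool (rooted W r (g(v := y))) * (\<Prod>x\<in>?S. w x (g x))) =
         (\<Sum>g\<in>?S \<rightarrow>\<^sub>E insert r ?S. of_bool (rooted W r (g(v := y))) * (\<Prod>x\<in>?S. w x (g x)))"
        using sub zero fin by (intro sum.mono_neutral_right finite_PiE) auto
      also have "\<dots> = (\<Sum>g\<in>?S \<rightarrow>\<^sub>E insert r ?S. of_bool (rooted ?S r g) * (\<Prod>x\<in>?S. w x (g x)))"
        by (intro sum.cong refl) (simp add: eq)
      finally show ?thesis by (simp add: sum_distrib_left[symmetric])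
    qed
  qed
  finally show ?thesis unfolding arbo_def by (simp add: sum_distrib_right)
qed

text \<open>A Schur complement at \<open>v\<close>: the other rows are changed one after another
  until column \<open>v\<close> is zero, then \<open>arbo_leaf\<close> removes \<open>v\<close>.
  That \<open>w v v\<close> is 0 keeps the corrected rows zero in this column.\<close>

lemma arbo_eliminate:
  assumes v: "v \<in> W" "r \<notin> W" and fin: "finite W" and loop: "w v v = 0"
    and s: "s = (\<Sum>z\<in>insert r W. w v z)" "s \<noteq> 0"
  shows "arbo W r w = s * arbo (W - {v}) r (\<lambda>u z. w u z + w u v * w v z / s)"
proof -
  define row where "row u = (\<lambda>z. ((w u)(v := 0)) z + w u v / s * w v z)" for u
  have "arbo W r w = arbo W r (\<lambda>u. if u \<in> S then row u else w u)" if "S \<subseteq> W - {v}" for S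
    using finite_subset[OF that] that fin
  proof (induction S rule: infinite_finite_induct)
    case (insert u S)
    let ?w = "\<lambda>u. if u \<in> S then row u else w u"
    have u: "u \<in> W" "u \<noteq> v" "v \<notin> S" using insert by auto
    have wv: "?w v = w v" using u by simp
    have "arbo W r w = arbo W r ?w" using insert by auto
    \<comment> \<open>Row \<open>u\<close> splits into its part off column \<open>v\<close> and
      \<open>w u v\<close> times the row pointing only to \<open>v\<close>;
      \<open>arbo_row_reduce\<close> trades the latter for row \<open>v\<close> divided by
      \<open>s\<close>.\<close>
    also have "?w = ?w(u := \<lambda>z. ((w u)(v := 0)) z + w u v * of_bool (z = v))"
      using insert by (auto simp: fun_eq_iff)
    also have "arbo W r \<dots> = arbo W r (?w(u := (w u)(v := 0))) + w u v * arbo W r (?w(u := \<lambda>z. of_bool (z = v)))"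
      using u fin by (rule_tac arbo_row_linear)
    also have "arbo W r (?w(u := \<lambda>z. of_bool (z = v))) = arbo W r (?w(u := w v)) / s"
      using arbo_row_reduce[of u v W r ?w] u v fin s by (simp add: wv)
    also have "arbo W r (?w(u := (w u)(v := 0))) + w u v * (arbo W r (?w(u := w v)) / s) =
        arbo W r (?w(u := row u))"
      using arbo_row_linear[OF u(1) fin, of r ?w "(w u)(v := 0)" "w u v / s" "w v"]
      by (simp only: row_def[of u] times_divide_eq_right times_divide_eq_left)
    also have "?w(u := row u) = (\<lambda>x. if x \<in> insert u S then row x else w x)" by auto
    finally show ?case .
  qed auto
  from this[of "W - {v}"] have "arbo W r w = arbo W r (\<lambda>u. if u \<in> W - {v} then row u else w u)" by simp
  also have "\<dots> = (\<Sum>z\<in>insert r W. (\<lambda>u. if u \<in> W - {v} then row u else w u) v z) *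
      arbo (W - {v}) r (\<lambda>u. if u \<in> W - {v} then row u else w u)"
    using v fin loop by (intro arbo_leaf) (auto simp: row_def)
  also have "arbo (W - {v}) r (\<lambda>u. if u \<in> W - {v} then row u else w u) =
      arbo (W - {v}) r (\<lambda>u z. w u z + w u v * w v z / s)"
    using v by (intro arbo_cong) (auto simp: row_def)
  finally show ?thesis using s by simp
qed

section \<open>Spanning trees as parent maps\<close>

lemma simple_graphD: "simple_graph V E \<Longrightarrow> {u, w} \<in> E \<Longrightarrow> u \<in> V \<and> w \<in> V \<and> u \<noteq> w"
proof -
  assume "simple_graph V E" "{u, w} \<in> E"
  then have "{u, w} \<subseteq> V" "card {u, w} = 2" by (simp_all only: simple_graph_def)
  then show ?thesis by (cases "u = w") auto
qed

text \<open>Breadth-first parents: every vertex other than \<open>r\<close> picks a neighbour at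
  smaller distance \<open>d\<close> from \<open>r\<close>.\<close>

lemma connected_parent_map:
  assumes con: "connected_graph V E" and r: "r \<in> V"
  obtains f where "f \<in> (V - {r}) \<rightarrow>\<^sub>E V" "rooted (V - {r}) r f" "\<And>u. u \<in> V - {r} \<Longrightarrow> {u, f u} \<in> E"
proof -
  define R where "R = {(x, y). {x, y} \<in> E}"
  define d where "d u = (LEAST n. (u, r) \<in> R ^^ n)" for u
  have ex: "\<exists>y. (u, y) \<in> R \<and> d y < d u" if u: "u \<in> V - {r}" for u
  proof -
    have "(u, r) \<in> R\<^sup>*" using con r u by (auto simp: connected_graph_def R_def)
    then have "\<exists>n. (u, r) \<in> R ^^ n" by (simp add: rtrancl_power)
    then have *: "(u, r) \<in> R ^^ d u" unfolding d_def by (rule LeastI_ex)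
    have "d u \<noteq> 0"
    proof
      assume "d u = 0"
      with * u show False by simp
    qed
    then obtain n where n: "d u = Suc n" using not0_implies_Suc by blast
    from * obtain y where y: "(u, y) \<in> R" "(y, r) \<in> R ^^ n"
      unfolding n by (meson relpow_Suc_D2)
    then have "d y \<le> n" unfolding d_def by (intro Least_le)
    with y n show ?thesis by auto
  qed
  define f where "f = (\<lambda>u\<in>V - {r}. SOME y. (u, y) \<in> R \<and> d y < d u)"
  have f: "(u, f u) \<in> R \<and> d (f u) < d u" if "u \<in> V - {r}" for u
    using someI_ex[OF ex[OF that]] that by (simp add: f_def)
  have fE: "{u, f u} \<in> E" if "u \<in> V - {r}" for u
    using f[OF that] by (simp add: R_def)
  have fV: "f u \<in> V" if "u \<in> V - {r}" for u
    using simple_graphD[OF _ fE[OF that]] con by (auto simp: connected_graph_def)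
  show thesis
  proof (rule that)
    show "f \<in> (V - {r}) \<rightarrow>\<^sub>E V" using fV by (auto simp: f_def)
    show "rooted (V - {r}) r f"
      using fV f by (intro rootedI_rank[where d = d]) auto
    show "\<And>u. u \<in> V - {r} \<Longrightarrow> {u, f u} \<in> E" by (rule fE)
  qed
qed

text \<open>Two vertices with the same parent edge would be parents of each other, against the rank.
  Products over vertices thus become products over edges.\<close>

lemma parent_edges_inj:
  assumes "rooted W r f" "r \<notin> W"
  shows "inj_on (\<lambda>u. {u, f u}) W"
proof
  obtain d :: "'a \<Rightarrow> nat" where d: "\<And>u. u \<in> W \<Longrightarrow> d (f u) < d u"
    using reaches_rank[OF assms] by blast
  fix x y assume "x \<in> W" "y \<in> W" "{x, f x} = {y, f y}"
  then show "x = y" using d[of x] d[of y] by (auto simp: doubleton_eq_iff)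
qed

lemma parent_map_connected:
  assumes r: "r \<in> V" and fin: "finite V" and f: "\<And>u. u \<in> V - {r} \<Longrightarrow> f u \<in> V"
    and rt: "rooted (V - {r}) r f"
  shows "connected_graph V ((\<lambda>u. {u, f u}) ` (V - {r}))"
proof -
  let ?T = "(\<lambda>u. {u, f u}) ` (V - {r})"
  let ?R = "{(x, y). {x, y} \<in> ?T}"
  obtain d :: "'a \<Rightarrow> nat" where d: "\<And>u. u \<in> V - {r} \<Longrightarrow> d (f u) < d u"
    using reaches_rank[OF rt] by blast
  have ne: "u \<noteq> f u" if "u \<in> V - {r}" for u using d[OF that] by auto
  have simple: "simple_graph V ?T"
    unfolding simple_graph_def using fin f ne by (auto simp: card_2_iff)
  have toroot: "u \<in> V \<longrightarrow> (u, r) \<in> ?R\<^sup>*" if "reaches f r u" for u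
    using that
  proof induction
    case (step u)
    show ?case
    proof (cases "u \<in> V - {r}")
      case True
      then have "(u, f u) \<in> ?R" by auto
      with step True f show ?thesis by (auto intro: converse_rtrancl_into_rtrancl)
    qed auto
  qed auto
  then have "(u, r) \<in> ?R\<^sup>*" if "u \<in> V" for u
    using that rt by (cases "u = r") (auto simp: rooted_def)
  moreover have "sym (?R\<^sup>*)" by (intro sym_rtrancl) (auto simp: sym_def insert_commute)
  ultimately have "(u, v) \<in> ?R\<^sup>*" if "u \<in> V" "v \<in> V" for u v
    using that by (meson rtrancl_trans symD)
  with simple r show ?thesis unfolding connected_graph_def by blast
qed

text \<open>On a cycle, a vertex of maximal rank would have both of its distinct neighbours as parent.\<close>

lemma parent_map_tree:
  assumes r: "r \<in> V" and fin: "finite V" and f: "\<And>u. u \<in> V - {r} \<Longrightarrow> f u \<in> V"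
    and rt: "rooted (V - {r}) r f"
  shows "tree_graph V ((\<lambda>u. {u, f u}) ` (V - {r}))"
proof -
  let ?T = "(\<lambda>u. {u, f u}) ` (V - {r})"
  obtain d :: "'a \<Rightarrow> nat" where d: "\<And>u. u \<in> V - {r} \<Longrightarrow> d (f u) < d u"
    using reaches_rank[OF rt] by blast
  have False if p: "graph_cycle ?T p" for p
  proof -
    let ?n = "length p"
    have n: "3 \<le> ?n" and dist: "distinct p"
      and e: "\<And>i. i < ?n \<Longrightarrow> {p ! i, p ! (Suc i mod ?n)} \<in> ?T"
      using p by (auto simp: graph_cycle_def)
    have "\<exists>i. i < ?n \<and> (\<forall>j. j < ?n \<longrightarrow> d (p ! j) \<le> d (p ! i))"
    proof -
      have "finite ((\<lambda>i. d (p ! i)) ` {..<?n})" "(\<lambda>i. d (p ! i)) ` {..<?n} \<noteq> {}"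
        using n by (auto simp: lessThan_empty_iff)
      from Max_in[OF this] Max_ge[OF this(1)] show ?thesis by fastforce
    qed
    then obtain i where i: "i < ?n" and mx: "\<And>j. j < ?n \<Longrightarrow> d (p ! j) \<le> d (p ! i)" by blast
    \<comment> \<open>The cyclic predecessor of \<open>i\<close>. It differs from the cyclic
      successor because a cycle has at least 3 vertices.\<close>
    define k where "k = (if i = 0 then ?n - 1 else i - 1)"
    have k: "k < ?n" "Suc k mod ?n = i" using i n by (auto simp: k_def)
    have par: "w = f (p ! i)" if "{p ! i, w} \<in> ?T" "d w \<le> d (p ! i)" for w
    proof -
      obtain u where u: "u \<in> V - {r}" "{p ! i, w} = {u, f u}" using \<open>{p ! i, w} \<in> ?T\<close> by auto
      then show ?thesis using d[OF u(1)] that(2) by (auto simp: doubleton_eq_iff)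
    qed
    have "Suc i mod ?n < ?n" by (rule mod_less_divisor) (use n in linarith)
    then have 1: "p ! (Suc i mod ?n) = f (p ! i)" using par e[OF i] mx by blast
    have 2: "p ! k = f (p ! i)" using par e[OF k(1)] k mx by (simp add: insert_commute)
    have "k \<noteq> Suc i mod ?n"
    proof (cases "Suc i < ?n")
      case True
      then show ?thesis using n by (auto simp: k_def)
    next
      case False
      then have "Suc i = ?n" using i by simp
      then show ?thesis using n by (auto simp: k_def)
    qed
    then show False using 1 2 dist k(1) \<open>Suc i mod ?n < ?n\<close> by (metis nth_eq_iff_index_eq)
  qed
  with parent_map_connected[OF assms] show ?thesis by (auto simp: tree_graph_def)
qed

text \<open>Where \<open>f x\<close> and \<open>g x\<close> differ, the edge \<open>{x, f x}\<close>
  can only be the \<open>g\<close>-edge of \<open>f x\<close>, so \<open>g (f x) = x\<close> and the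
  maps differ at \<open>f x\<close> too. The disagreement would follow \<open>f\<close> forever and
  never meet \<open>r\<close>.\<close>

lemma parent_map_unique:
  assumes f: "f \<in> W \<rightarrow>\<^sub>E insert r W" "rooted W r f" and g: "g \<in> W \<rightarrow>\<^sub>E insert r W" "rooted W r g"
    and r: "r \<notin> W" and eq: "(\<lambda>u. {u, f u}) ` W = (\<lambda>u. {u, g u}) ` W"
  shows "f = g"
proof (rule PiE_ext[OF f(1) g(1)])
  fix u assume u: "u \<in> W"
  obtain d :: "'a \<Rightarrow> nat" where d: "\<And>u. u \<in> W \<Longrightarrow> d (f u) < d u"
    using reaches_rank[OF f(2) r] by blast
  show "f u = g u"
  proof (rule ccontr)
    assume ne: "f u \<noteq> g u"
    have next_diff: "f x \<in> W \<and> f (f x) \<noteq> g (f x)" if x: "x \<in> W" "f x \<noteq> g x" for x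
    proof -
      have "{x, f x} \<in> (\<lambda>u. {u, g u}) ` W" using x eq by blast
      then obtain y where y: "y \<in> W" "{x, f x} = {y, g y}" by auto
      then have "y = f x" "g (f x) = x" using x by (auto simp: doubleton_eq_iff)
      moreover have "f (f x) \<noteq> x" using d[OF x(1)] d[of "f x"] y(1) calculation by auto
      ultimately show ?thesis using y by auto
    qed
    have "\<not> reaches f r u"
      by (rule reaches_closed[where C = "{x \<in> W. f x \<noteq> g x}"]) (use next_diff u ne r in auto)
    then show False using f(2) u by (simp add: rooted_def)
  qed
qed

lemma rtrancl_distinct_path:
  assumes "(a, b) \<in> {(x, y). P x y}\<^sup>*"
  shows "\<exists>p. p \<noteq> [] \<and> hd p = a \<and> last p = b \<and> distinct p \<and> successively P p"
  using assms
proof (induction rule: converse_rtrancl_induct)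
  case base
  show ?case by (intro exI[of _ "[b]"]) simp
next
  case (step a c)
  then obtain p where p: "p \<noteq> []" "hd p = c" "last p = b" "distinct p" "successively P p" by blast
  show ?case
  proof (cases "a \<in> set p")
    case True
    then obtain xs ys where "p = xs @ a # ys" by (meson split_list)
    with p show ?thesis by (intro exI[of _ "a # ys"]) (auto simp: successively_append_iff)
  next
    case False
    with p step(1) show ?thesis
      by (intro exI[of _ "a # p"]) (auto simp: successively_Cons)
  qed
qed

text \<open>Breadth-first parents already trace a connected subgraph; any further edge would close a
  cycle with the path between its ends.\<close>

lemma tree_parent_map:
  assumes T: "tree_graph V T" and r: "r \<in> V"
  obtains f where "f \<in> (V - {r}) \<rightarrow>\<^sub>E V" "rooted (V - {r}) r f" "T = (\<lambda>u. {u, f u}) ` (V - {r})"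
proof -
  have con: "connected_graph V T" and nocyc: "\<And>p. \<not> graph_cycle T p"
    using T by (auto simp: tree_graph_def)
  obtain f where f: "f \<in> (V - {r}) \<rightarrow>\<^sub>E V" "rooted (V - {r}) r f"
    "\<And>u. u \<in> V - {r} \<Longrightarrow> {u, f u} \<in> T"
    using connected_parent_map[OF con r] by blast
  let ?T = "(\<lambda>u. {u, f u}) ` (V - {r})"
  have fin: "finite V" using con by (simp add: connected_graph_def simple_graph_def)
  have con': "connected_graph V ?T"
    by (rule parent_map_connected[OF r fin _ f(2)]) (use f(1) in auto)
  have sub: "?T \<subseteq> T" using f(3) by auto
  have "e \<in> ?T" if e: "e \<in> T" for e
  proof (rule ccontr)
    assume ne: "e \<notin> ?T"
    have "card e = 2" "e \<subseteq> V" using con e by (auto simp: connected_graph_def simple_graph_def)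
    then obtain a b where ab: "e = {a, b}" "a \<noteq> b" "a \<in> V" "b \<in> V" by (auto simp: card_2_iff)
    have "(a, b) \<in> {(x, y). {x, y} \<in> ?T}\<^sup>*" using con' ab by (simp add: connected_graph_def)
    from rtrancl_distinct_path[OF this] obtain p where p: "p \<noteq> []" "hd p = a" "last p = b"
      "distinct p" "successively (\<lambda>x y. {x, y} \<in> ?T) p" by blast
    \<comment> \<open>A path of two vertices would be \<open>e\<close> itself, which is not in
      \<open>?T\<close>; a single vertex would give \<open>a = b\<close>.\<close>
    have len: "3 \<le> length p"
    proof (rule ccontr)
      assume "\<not> 3 \<le> length p"
      then consider "length p = Suc 0" | "length p = Suc (Suc 0)"
        using p(1) length_0_conv[of p] by linarith
      then show False using p ab ne
        by cases (auto simp: length_Suc_conv)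
    qed
    have "graph_cycle T p" unfolding graph_cycle_def
    proof (intro conjI allI impI len p(4))
      fix i assume i: "i < length p"
      show "{p ! i, p ! (Suc i mod length p)} \<in> T"
      proof (cases "Suc i < length p")
        case True
        then show ?thesis using p(5) sub by (auto simp: successively_conv_nth)
      next
        \<comment> \<open>The closing edge, from the last vertex \<open>b\<close> back to
          \<open>a\<close>, is \<open>e\<close>.\<close>
        case False
        then have "Suc i = length p" using i by simp
        moreover from this have "p ! i = b" using p by (metis diff_Suc_1 last_conv_nth)
        ultimately show ?thesis using p e ab by (simp add: hd_conv_nth[symmetric] insert_commute)
      qed
    qed
    with nocyc show False by blast
  qed
  with sub have "T = ?T" by blast
  with f that show thesis by blast
qed

text \<open>Orienting a spanning tree towards \<open>r\<close> is a bijection onto the rooted parent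
  maps along edges; all other maps contribute 0. The root is arbitrary, so an elimination can choose
  one different from \<open>v\<close>.\<close>

lemma spanning_tree_poly_arbo:
  assumes G: "simple_graph V E" and r: "r \<in> V"
  shows "spanning_tree_poly V E x =
    arbo (V - {r}) r (\<lambda>u z. if {u, z} \<in> E then x {u, z} else 0)"
proof -
  let ?W = "V - {r}"
  let ?ed = "\<lambda>f. (\<lambda>u. {u, f u}) ` ?W"
  let ?F = "{f \<in> ?W \<rightarrow>\<^sub>E V. rooted ?W r f \<and> (\<forall>u\<in>?W. {u, f u} \<in> E)}"
  have fin: "finite V" using G by (simp add: simple_graph_def)
  have ins: "insert r ?W = V" using r by auto
  have bij: "bij_betw ?ed ?F (spanning_trees V E)"
    unfolding bij_betw_def
  proof
    show "inj_on ?ed ?F"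
      by (rule inj_onI, rule parent_map_unique[where W = ?W and r = r]) (auto simp: ins)
    show "?ed ` ?F = spanning_trees V E"
    proof (intro equalityI subsetI)
      fix T assume "T \<in> ?ed ` ?F"
      then obtain f where f: "f \<in> ?F" "T = ?ed f" by blast
      then have "tree_graph V T" using parent_map_tree[OF r fin, of f] by auto
      with f show "T \<in> spanning_trees V E" by (auto simp: spanning_trees_def)
    next
      fix T assume "T \<in> spanning_trees V E"
      then have T: "T \<subseteq> E" "tree_graph V T" by (auto simp: spanning_trees_def)
      obtain f where f: "f \<in> ?W \<rightarrow>\<^sub>E V" "rooted ?W r f" "T = ?ed f"
        using tree_parent_map[OF T(2) r] by blast
      then show "T \<in> ?ed ` ?F" using T by (intro image_eqI[of _ _ f]) auto
    qed
  qed
  have "arbo ?W r (\<lambda>u z. if {u, z} \<in> E then x {u, z} else 0) =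
    (\<Sum>f\<in>?W \<rightarrow>\<^sub>E V. of_bool (rooted ?W r f) * (\<Prod>u\<in>?W. if {u, f u} \<in> E then x {u, f u} else 0))"
    unfolding arbo_def ins ..
  also have "\<dots> = (\<Sum>f\<in>?F. \<Prod>u\<in>?W. x {u, f u})"
  proof (rule sum.mono_neutral_cong_right)
    show "finite (?W \<rightarrow>\<^sub>E V)" using fin by (intro finite_PiE) auto
    show "\<forall>f\<in>(?W \<rightarrow>\<^sub>E V) - ?F.
        of_bool (rooted ?W r f) * (\<Prod>u\<in>?W. if {u, f u} \<in> E then x {u, f u} else 0) = 0"
    proof
      fix f assume f: "f \<in> (?W \<rightarrow>\<^sub>E V) - ?F"
      show "of_bool (rooted ?W r f) * (\<Prod>u\<in>?W. if {u, f u} \<in> E then x {u, f u} else 0) = 0"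
      proof (cases "rooted ?W r f")
        case True
        with f obtain u where "u \<in> ?W" "{u, f u} \<notin> E" by auto
        then have "(\<Prod>u\<in>?W. if {u, f u} \<in> E then x {u, f u} else 0) = 0"
          using fin by (intro prod_zero bexI[of _ u]) auto
        then show ?thesis by simp
      qed simp
    qed
  qed auto
  also have "\<dots> = (\<Sum>f\<in>?F. \<Prod>e\<in>?ed f. x e)"
  proof (intro sum.cong refl)
    fix f assume "f \<in> ?F"
    then have "inj_on (\<lambda>u. {u, f u}) ?W" using parent_edges_inj[of ?W r f] by auto
    then show "(\<Prod>u\<in>?W. x {u, f u}) = (\<Prod>e\<in>?ed f. x e)"
      by (simp add: prod.reindex)
  qed
  also have "\<dots> = (\<Sum>T\<in>spanning_trees V E. \<Prod>e\<in>T. x e)"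
    by (rule sum.reindex_bij_betw[OF bij])
  finally show ?thesis by (simp add: spanning_tree_poly_def)
qed

section \<open>Eliminating a vertex\<close>

definition nbrs :: "'a set set \<Rightarrow> 'a \<Rightarrow> 'a set" where
  "nbrs E v = {u. {u, v} \<in> E}"

definition elim_edges :: "'a set set \<Rightarrow> 'a \<Rightarrow> 'a set set" where
  "elim_edges E v = {e \<in> E. v \<notin> e} \<union> {e. e \<subseteq> nbrs E v \<and> card e = 2}"

definition star_weight :: "'a set set \<Rightarrow> 'a \<Rightarrow> ('a set \<Rightarrow> real) \<Rightarrow> real" where
  "star_weight E v x = (\<Sum>u\<in>nbrs E v. x {u, v})"

text \<open>For \<open>e = {u, w}\<close> the product is that of the weights of \<open>{u, v}\<close> and \<open>{w, v}\<close>.\<close>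

definition star_mesh :: "'a set set \<Rightarrow> 'a \<Rightarrow> ('a set \<Rightarrow> real) \<Rightarrow> 'a set \<Rightarrow> real" where
  "star_mesh E v x e = (if e \<in> E then x e else 0) +
     (if e \<subseteq> nbrs E v then (\<Prod>u\<in>e. x {u, v}) / star_weight E v x else 0)"

text \<open>The correction \<open>w u v * w v z / s\<close> is symmetric in \<open>u\<close> and
  \<open>z\<close>, so \<open>arbo_eliminate\<close>, although directed, ends in an undirected graph
  again.\<close>

lemma spanning_tree_poly_star_mesh:
  assumes G: "simple_graph V E" and v: "v \<in> V" "V \<noteq> {v}" and s: "star_weight E v x \<noteq> 0"
  shows "spanning_tree_poly V E x =
    star_weight E v x * spanning_tree_poly (V - {v}) (elim_edges E v) (star_mesh E v x)"
proof -
  obtain r where r: "r \<in> V" "r \<noteq> v" using v by blast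
  let ?W = "V - {r}"
  let ?w = "\<lambda>u z. if {u, z} \<in> E then x {u, z} else 0"
  let ?s = "star_weight E v x"
  have fin: "finite V" using G by (simp add: simple_graph_def)
  have N: "nbrs E v \<subseteq> V" "v \<notin> nbrs E v"
    using simple_graphD[OF G] simple_graphD[OF G, of v v] by (auto simp: nbrs_def)
  have ins: "insert r ?W = V" using r by auto
  have s_eq: "?s = (\<Sum>z\<in>insert r ?W. ?w v z)"
  proof -
    have "(\<Sum>z\<in>V. ?w v z) = (\<Sum>z\<in>V. if z \<in> nbrs E v then x {z, v} else 0)"
      by (intro sum.cong) (auto simp: nbrs_def insert_commute)
    also have "\<dots> = (\<Sum>z\<in>V \<inter> nbrs E v. x {z, v})"
      using fin by (simp add: sum.inter_restrict)
    finally show ?thesis using N unfolding ins by (simp add: star_weight_def Int_absorb1)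
  qed
  have simple': "simple_graph (V - {v}) (elim_edges E v)"
    using G N unfolding simple_graph_def elim_edges_def by auto
  have "spanning_tree_poly V E x = arbo ?W r ?w"
    by (rule spanning_tree_poly_arbo[OF G r(1)])
  also have "\<dots> = ?s * arbo (?W - {v}) r (\<lambda>u z. ?w u z + ?w u v * ?w v z / ?s)"
    by (rule arbo_eliminate[where w = ?w and W = ?W and r = r, OF _ _ _ _ s_eq s]) (use v r fin simple_graphD[OF G, of v v] in auto)
  also have "arbo (?W - {v}) r (\<lambda>u z. ?w u z + ?w u v * ?w v z / ?s) =
     arbo (?W - {v}) r (\<lambda>u z. if {u, z} \<in> elim_edges E v then star_mesh E v x {u, z} else 0)"
  proof (rule arbo_cong)
    fix u z assume u: "u \<in> ?W - {v}" and z: "z \<in> insert r (?W - {v})" and ne: "u \<noteq> z"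
    have uz: "u \<noteq> v" "z \<noteq> v" using u z r by auto
    have nu: "{u, v} \<in> E \<longleftrightarrow> u \<in> nbrs E v" and nz: "{v, z} \<in> E \<longleftrightarrow> z \<in> nbrs E v"
      by (auto simp: nbrs_def insert_commute)
    have vz: "x {v, z} = x {z, v}" by (simp add: insert_commute)
    show "?w u z + ?w u v * ?w v z / ?s =
      (if {u, z} \<in> elim_edges E v then star_mesh E v x {u, z} else 0)"
      using ne uz by (auto simp: elim_edges_def star_mesh_def nu nz vz)
  qed auto
  also have "\<dots> = spanning_tree_poly (V - {v}) (elim_edges E v) (star_mesh E v x)"
  proof -
    have "?W - {v} = V - {v} - {r}" by auto
    then show ?thesis using spanning_tree_poly_arbo[OF simple', of r "star_mesh E v x"] r by simp
  qed
  finally show ?thesis .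
qed

section \<open>Mixtures\<close>

text \<open>Iterating one-dimensional integrals takes the place of a representing measure on the space of
  generators, so that no measurable choice of coordinates is ever needed.\<close>

inductive mixture :: "'p set \<Rightarrow> ('p \<Rightarrow> real) set \<Rightarrow> ('p \<Rightarrow> real) \<Rightarrow> bool" for D G where
  gen: "g \<in> G \<Longrightarrow> mixture D G g"
| int: "(\<And>t. w t \<noteq> 0 \<Longrightarrow> mixture D G (F t)) \<Longrightarrow> (\<And>t::real. 0 \<le> w t) \<Longrightarrow>
    (\<And>x. x \<in> D \<Longrightarrow> ((\<lambda>t. w t * F t x) has_integral g x) UNIV) \<Longrightarrow> mixture D G g"

text \<open>A multiple is an integral over the unit interval with constant weight \<open>c\<close>.
  Only \<open>int\<close> forgets values outside \<open>D\<close>, so mere agreement on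
  \<open>D\<close> is also handled by an integral.\<close>

lemma mixture_scale:
  assumes "mixture D G f" "0 \<le> c" "\<And>x. x \<in> D \<Longrightarrow> g x = c * f x"
  shows "mixture D G g"
proof (rule mixture.int[where w = "\<lambda>t. c * indicator {0..1::real} t" and F = "\<lambda>t. f"])
  fix x assume x: "x \<in> D"
  have "((\<lambda>t. c * f x) has_integral c * f x) {0..1::real}"
    using has_integral_const_real[of "c * f x" 0 1] by simp
  then have "((\<lambda>t. if t \<in> {0..1::real} then c * f x else 0) has_integral c * f x) UNIV"
    by (simp only: has_integral_restrict_UNIV)
  moreover have "(\<lambda>t. if t \<in> {0..1::real} then c * f x else 0) = (\<lambda>t. c * indicator {0..1::real} t * f x)"
    by (auto simp: fun_eq_iff)
  ultimately show "((\<lambda>t. c * indicator {0..1::real} t * f x) has_integral g x) UNIV"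
    using assms(3)[OF x] by (simp only:)
qed (use assms(1,2) in simp_all)

lemma mixture_cong:
  assumes "mixture D G f" "\<And>x. x \<in> D \<Longrightarrow> g x = f x"
  shows "mixture D G g"
  by (rule mixture_scale[OF assms(1), of 1]) (simp_all add: assms(2))

text \<open>Multiplication by \<open>c x\<close> and substitution of \<open>\<phi> x\<close> act at
  fixed \<open>x\<close>, hence inside every integral, and only the generators need
  attention.\<close>

lemma mixture_subst:
  assumes "mixture D G f" and "\<And>x. x \<in> D' \<Longrightarrow> \<phi> x \<in> D"
    and "\<And>g. g \<in> G \<Longrightarrow> mixture D' G' (\<lambda>x. c x * g (\<phi> x))"
  shows "mixture D' G' (\<lambda>x. c x * f (\<phi> x))"
  using assms(1)
proof induction
  case (gen g)
  then show ?case by (rule assms(3))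
next
  case (int w F g)
  show ?case
  proof (rule mixture.int[where w = w and F = "\<lambda>t x. c x * F t (\<phi> x)"])
    fix x assume "x \<in> D'"
    then have "((\<lambda>t. c x * (w t * F t (\<phi> x))) has_integral c x * g (\<phi> x)) UNIV"
      using int.hyps(3) assms(2) by (intro has_integral_mult_right) auto
    then show "((\<lambda>t. w t * (c x * F t (\<phi> x))) has_integral c x * g (\<phi> x)) UNIV"
      by (simp add: mult_ac)
  qed (simp_all add: int.IH int.hyps(2))
qed

section \<open>Gaussian and Gamma integrals of mixtures\<close>

lemma has_integral_exp_quadratic:
  fixes s m :: real
  assumes "s > 0"
  shows "((\<lambda>p. exp (- s * (p - m)\<^sup>2)) has_integral sqrt (pi / s)) UNIV"
proof -
  \<comment> \<open>The variance \<open>1 / (2 * s)\<close> turns the exponent of the normal density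
    into \<open>- s * (p - m)\<^sup>2\<close>.\<close>
  define \<sigma> where "\<sigma> = 1 / sqrt (2 * s)"
  have \<sigma>: "\<sigma> > 0" "2 * \<sigma>\<^sup>2 = 1 / s" using assms by (auto simp: \<sigma>_def power_divide)
  have "(normal_density m \<sigma> has_integral 1) UNIV"
    using has_integral_integral_lborel[OF integrable_normal_density[OF \<sigma>(1)], of m]
      integral_normal_density[OF \<sigma>(1)] by simp
  then have "((\<lambda>p. sqrt (pi / s) * normal_density m \<sigma> p) has_integral sqrt (pi / s) * 1) UNIV"
    by (rule has_integral_mult_right)
  moreover have "sqrt (pi / s) * normal_density m \<sigma> p = exp (- s * (p - m)\<^sup>2)" for p
  proof -
    have "2 * pi * \<sigma>\<^sup>2 = pi / s" using \<sigma>(2) by (simp add: field_simps)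
    moreover have "(p - m)\<^sup>2 / (2 * \<sigma>\<^sup>2) = s * (p - m)\<^sup>2" by (simp add: \<sigma>(2))
    ultimately show ?thesis using assms by (simp add: normal_density_def)
  qed
  ultimately show ?thesis by simp
qed

text \<open>Completing the square at the weighted mean; the part free of \<open>p\<close> is the
  weighted sum of squared deviations from that mean.\<close>

lemma weighted_square_sum:
  fixes y q :: "'u \<Rightarrow> real"
  assumes "(\<Sum>u\<in>N. y u) \<noteq> 0"
  shows "(\<Sum>u\<in>N. y u * (q u - p)\<^sup>2) =
    (\<Sum>u\<in>N. y u) * (p - (\<Sum>u\<in>N. y u * q u) / (\<Sum>u\<in>N. y u))\<^sup>2 +
    ((\<Sum>u\<in>N. y u * (q u)\<^sup>2) - (\<Sum>u\<in>N. y u * q u)\<^sup>2 / (\<Sum>u\<in>N. y u))"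
proof -
  let ?s = "\<Sum>u\<in>N. y u" and ?m = "\<Sum>u\<in>N. y u * q u" and ?r = "\<Sum>u\<in>N. y u * (q u)\<^sup>2"
  have "(\<Sum>u\<in>N. y u * (q u - p)\<^sup>2) = (\<Sum>u\<in>N. y u * (q u)\<^sup>2 - 2 * p * (y u * q u) + p\<^sup>2 * y u)"
    by (intro sum.cong) (auto simp: power2_eq_square algebra_simps)
  also have "\<dots> = ?r - 2 * p * ?m + p\<^sup>2 * ?s"
    by (simp add: sum.distrib sum_subtractf sum_distrib_left)
  also have "\<dots> = ?s * (p - ?m / ?s)\<^sup>2 + (?r - ?m\<^sup>2 / ?s)"
    using assms by (simp add: power2_eq_square field_simps)
  finally show ?thesis .
qed

text \<open>The weight \<open>1 / sqrt pi\<close> cancels the \<open>pi\<close> of the Gaussian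
  integral, so that exactly the total weight to the power \<open>- 1 / 2\<close> remains.\<close>

lemma mixture_gauss:
  fixes y :: "'p \<Rightarrow> 'u \<Rightarrow> real" and q :: "'u \<Rightarrow> real"
  assumes mix: "\<And>p. mixture D G (\<lambda>x. R x * exp (- (\<Sum>u\<in>N. y x u * (q u - p)\<^sup>2)))"
    and s: "\<And>x. x \<in> D \<Longrightarrow> (\<Sum>u\<in>N. y x u) > 0"
  shows "mixture D G (\<lambda>x. R x * ((\<Sum>u\<in>N. y x u) powr (- 1 / 2) *
    exp (- ((\<Sum>u\<in>N. y x u * (q u)\<^sup>2) - (\<Sum>u\<in>N. y x u * q u)\<^sup>2 / (\<Sum>u\<in>N. y x u)))))"
proof (rule mixture.int[where w = "\<lambda>t. 1 / sqrt pi" and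
      F = "\<lambda>p x. R x * exp (- (\<Sum>u\<in>N. y x u * (q u - p)\<^sup>2))"])
  fix x assume "x \<in> D"
  then have s: "(\<Sum>u\<in>N. y x u) > 0" (is "?s > 0") by (rule s)
  let ?m = "(\<Sum>u\<in>N. y x u * q u) / ?s"
  let ?e = "exp (- ((\<Sum>u\<in>N. y x u * (q u)\<^sup>2) - (\<Sum>u\<in>N. y x u * q u)\<^sup>2 / ?s))"
  have "((\<lambda>p. (R x * ?e / sqrt pi) * exp (- ?s * (p - ?m)\<^sup>2)) has_integral
      (R x * ?e / sqrt pi) * sqrt (pi / ?s)) UNIV"
    using s by (intro has_integral_mult_right has_integral_exp_quadratic)
  also have "(\<lambda>p. (R x * ?e / sqrt pi) * exp (- ?s * (p - ?m)\<^sup>2)) =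
     (\<lambda>p. 1 / sqrt pi * (R x * exp (- (\<Sum>u\<in>N. y x u * (q u - p)\<^sup>2))))"
  proof
    fix p
    have "exp (- (\<Sum>u\<in>N. y x u * (q u - p)\<^sup>2)) = exp (- ?s * (p - ?m)\<^sup>2) * ?e"
      unfolding exp_add[symmetric] using s
      by (subst weighted_square_sum) auto
    then show "(R x * ?e / sqrt pi) * exp (- ?s * (p - ?m)\<^sup>2) =
       1 / sqrt pi * (R x * exp (- (\<Sum>u\<in>N. y x u * (q u - p)\<^sup>2)))" by simp
  qed
  also have "(R x * ?e / sqrt pi) * sqrt (pi / ?s) = R x * (?s powr (- 1 / 2) * ?e)"
  proof -
    have "?s powr (- 1 / 2) = 1 / sqrt ?s"
      using s powr_minus_divide[of ?s "1/2"] by (simp add: powr_half_sqrt)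
    then show ?thesis using s by (simp add: real_sqrt_divide)
  qed
  finally show "((\<lambda>p. 1 / sqrt pi * (R x * exp (- (\<Sum>u\<in>N. y x u * (q u - p)\<^sup>2)))) has_integral
      R x * (?s powr (- 1 / 2) * ?e)) UNIV" .
qed (simp_all add: mix)

lemma mixture_gauss_multi:
  fixes y :: "'p \<Rightarrow> 'u \<Rightarrow> real" and q :: "'u \<Rightarrow> nat \<Rightarrow> real"
  assumes mix: "\<And>p. mixture D G (\<lambda>x. R x * exp (- (\<Sum>j<d. \<Sum>u\<in>N. y x u * (q u j - p j)\<^sup>2)))"
    and s: "\<And>x. x \<in> D \<Longrightarrow> (\<Sum>u\<in>N. y x u) > 0"
  shows "mixture D G (\<lambda>x. R x * ((\<Sum>u\<in>N. y x u) powr (- real d / 2) *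
    exp (- (\<Sum>j<d. (\<Sum>u\<in>N. y x u * (q u j)\<^sup>2) - (\<Sum>u\<in>N. y x u * q u j)\<^sup>2 / (\<Sum>u\<in>N. y x u)))))"
  using mix
proof (induction d arbitrary: R)
  case 0
  show ?case
  proof (rule mixture_cong[OF 0])
    fix x assume "x \<in> D"
    \<comment> \<open>\<open>0 powr 0\<close> is 0, so the factor with exponent 0 is 1 only for a
      nonzero base.\<close>
    then have "(\<Sum>u\<in>N. y x u) \<noteq> 0" using s[of x] by simp
    then show "R x * ((\<Sum>u\<in>N. y x u) powr (- real 0 / 2) *
        exp (- (\<Sum>j<0. (\<Sum>u\<in>N. y x u * (q u j)\<^sup>2) - (\<Sum>u\<in>N. y x u * q u j)\<^sup>2 / (\<Sum>u\<in>N. y x u)))) =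
      R x * exp (- (\<Sum>j<0. \<Sum>u\<in>N. y x u * (q u j - undefined j)\<^sup>2))" by simp
  qed
next
  case (Suc d)
  let ?Q = "\<lambda>j x. (\<Sum>u\<in>N. y x u * (q u j)\<^sup>2) - (\<Sum>u\<in>N. y x u * q u j)\<^sup>2 / (\<Sum>u\<in>N. y x u)"
  let ?A = "\<lambda>x. (\<Sum>u\<in>N. y x u) powr (- real d / 2) * exp (- (\<Sum>j<d. ?Q j x))"
  \<comment> \<open>The factor of coordinate \<open>d\<close>, at a fixed position
    \<open>pd\<close>, is absorbed into \<open>R\<close> while the induction hypothesis integrates
    the coordinates below \<open>d\<close>; \<open>pd\<close> is integrated last.\<close>
  have "mixture D G (\<lambda>x. (R x * exp (- (\<Sum>u\<in>N. y x u * (q u d - pd)\<^sup>2))) * ?A x)" for pd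
  proof (rule Suc.IH)
    fix p
    show "mixture D G (\<lambda>x. R x * exp (- (\<Sum>u\<in>N. y x u * (q u d - pd)\<^sup>2)) *
        exp (- (\<Sum>j<d. \<Sum>u\<in>N. y x u * (q u j - p j)\<^sup>2)))"
      using Suc.prems[of "p(d := pd)"] by (rule mixture_cong) (simp add: exp_diff exp_minus field_simps)
  qed
  then have "mixture D G (\<lambda>x. (R x * ?A x) * exp (- (\<Sum>u\<in>N. y x u * (q u d - pd)\<^sup>2)))" for pd
    by (simp only: mult_ac)
  from mixture_gauss[OF this s]
  show ?case
  proof (rule mixture_cong)
    fix x assume "x \<in> D"
    have "(\<Sum>u\<in>N. y x u) powr (- real (Suc d) / 2) =
        (\<Sum>u\<in>N. y x u) powr (- real d / 2) * (\<Sum>u\<in>N. y x u) powr (- 1 / 2)"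
      unfolding powr_add[symmetric] by (rule arg_cong2[where f = "(powr)"]) (auto simp: field_simps)
    moreover have "exp (- (\<Sum>j<Suc d. ?Q j x)) = exp (- (\<Sum>j<d. ?Q j x)) * exp (- ?Q d x)"
      unfolding exp_add[symmetric] by simp
    ultimately show "R x * ((\<Sum>u\<in>N. y x u) powr (- real (Suc d) / 2) * exp (- (\<Sum>j<Suc d. ?Q j x))) =
      R x * ?A x * ((\<Sum>u\<in>N. y x u) powr (- 1 / 2) * exp (- ?Q d x))"
      by (simp only: mult_ac)
  qed
qed

text \<open>The Gamma integral after substituting \<open>s * t\<close> for \<open>t\<close>, done
  with nonnegative integrals; \<open>s powr (1 - \<gamma>)\<close> removes the power of
  \<open>s\<close> that the substitution leaves in the integrand.\<close>

lemma has_integral_Gamma_scaled: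
  fixes s \<gamma> :: real
  assumes s: "s > 0" and \<gamma>: "\<gamma> > 0"
  shows "((\<lambda>t. if t \<ge> 0 then t powr (\<gamma> - 1) * exp (- t * s) else 0) has_integral
    Gamma \<gamma> * s powr (- \<gamma>)) UNIV"
proof -
  let ?f = "\<lambda>t. if t \<in> {0..} then t powr (\<gamma> - 1) / exp t else 0"
  have "(?f has_integral Gamma \<gamma>) UNIV"
    using Gamma_integral_real[OF \<gamma>] by (simp only: has_integral_restrict_UNIV)
  then have "(\<integral>\<^sup>+t. ?f t \<partial>lborel) = Gamma \<gamma>"
    by (intro nn_integral_has_integral_lborel) auto
  then have "ennreal (Gamma \<gamma>) = s * (\<integral>\<^sup>+t. ?f (s * t) \<partial>lborel)"
    using nn_integral_real_affine[of "\<lambda>t. ennreal (?f t)" s 0] s by (simp cong: if_cong)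
  then have "(\<integral>\<^sup>+t. ?f (s * t) \<partial>lborel) = Gamma \<gamma> / s"
    using s by (simp add: divide_ennreal[symmetric] Gamma_real_pos less_imp_le \<gamma>
      ennreal_mult_divide_eq mult.commute[of "ennreal s"])
  then have "((\<lambda>t. ?f (s * t)) has_integral Gamma \<gamma> / s) UNIV"
    using s Gamma_real_pos[OF \<gamma>] by (intro nn_integral_has_integral) auto
  then have "((\<lambda>t. s powr (1 - \<gamma>) * ?f (s * t)) has_integral s powr (1 - \<gamma>) * (Gamma \<gamma> / s)) UNIV"
    by (rule has_integral_mult_right)
  also have "s powr (1 - \<gamma>) * (Gamma \<gamma> / s) = Gamma \<gamma> * s powr (- \<gamma>)"
    using s by (simp add: powr_diff powr_minus field_simps)
  also have "(\<lambda>t. s powr (1 - \<gamma>) * ?f (s * t)) =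
      (\<lambda>t. if t \<ge> 0 then t powr (\<gamma> - 1) * exp (- t * s) else 0)"
  proof
    fix t
    show "s powr (1 - \<gamma>) * ?f (s * t) = (if t \<ge> 0 then t powr (\<gamma> - 1) * exp (- t * s) else 0)"
    proof (cases "t \<ge> 0")
      case True
      have "s powr (1 - \<gamma>) * s powr (\<gamma> - 1) = 1" using s by (simp add: powr_add[symmetric])
      then have "s powr (1 - \<gamma>) * (s powr (\<gamma> - 1) * c) = c" for c by (metis mult.assoc mult_1)
      then show ?thesis using True s by (simp add: powr_mult exp_minus field_simps)
    next
      case False
      then show ?thesis using s by (simp add: zero_le_mult_iff)
    qed
  qed
  finally show ?thesis .
qed

text \<open>The Laplace transform of \<open>t powr (\<gamma> - 1) / Gamma \<gamma>\<close> is
  \<open>s powr (- \<gamma>)\<close>. The weight is 0 for negative \<open>t\<close>, where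
  \<open>mixture.int\<close> asks for no mixture.\<close>

lemma mixture_gamma:
  assumes mix: "\<And>t. t \<ge> 0 \<Longrightarrow> mixture D G (\<lambda>x. R x * exp (- t * s x))"
    and s: "\<And>x. x \<in> D \<Longrightarrow> s x > 0" and \<gamma>: "\<gamma> > 0"
  shows "mixture D G (\<lambda>x. R x * s x powr (- \<gamma>))"
proof (rule mixture.int[where w = "\<lambda>t. if t \<ge> 0 then t powr (\<gamma> - 1) / Gamma \<gamma> else 0" and
      F = "\<lambda>t x. R x * exp (- t * s x)"])
  have G: "Gamma \<gamma> > 0" using \<gamma> by (rule Gamma_real_pos)
  show "0 \<le> (if t \<ge> 0 then t powr (\<gamma> - 1) / Gamma \<gamma> else 0)" for t using G by simp
  fix x assume "x \<in> D"
  then have "((\<lambda>t. R x / Gamma \<gamma> * (if t \<ge> 0 then t powr (\<gamma> - 1) * exp (- t * s x) else 0)) has_integral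
     R x / Gamma \<gamma> * (Gamma \<gamma> * s x powr (- \<gamma>))) UNIV"
    using s \<gamma> by (intro has_integral_mult_right has_integral_Gamma_scaled)
  also have "(\<lambda>t. R x / Gamma \<gamma> * (if t \<ge> 0 then t powr (\<gamma> - 1) * exp (- t * s x) else 0)) =
      (\<lambda>t. (if t \<ge> 0 then t powr (\<gamma> - 1) / Gamma \<gamma> else 0) * (R x * exp (- t * s x)))"
    by (auto simp: fun_eq_iff)
  also have "R x / Gamma \<gamma> * (Gamma \<gamma> * s x powr (- \<gamma>)) = R x * s x powr (- \<gamma>)" using G by simp
  finally show "((\<lambda>t. (if t \<ge> 0 then t powr (\<gamma> - 1) / Gamma \<gamma> else 0) * (R x * exp (- t * s x)))
      has_integral R x * s x powr (- \<gamma>)) UNIV" .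
qed (use mix in \<open>simp split: if_splits\<close>)

section \<open>Mixed differences\<close>

text \<open>Each step is minus a forward difference, so the sign \<open>(-1) ^ length l\<close> is
  built in. An entry pairs a step length with a coordinate.\<close>

primrec mixed_diff :: "(real \<times> 'e) list \<Rightarrow> (('e \<Rightarrow> real) \<Rightarrow> real) \<Rightarrow> ('e \<Rightarrow> real) \<Rightarrow> real" where
  "mixed_diff [] f = f"
| "mixed_diff (he # l) f = mixed_diff l (\<lambda>x. f x - f (x(snd he := x (snd he) + fst he)))"

definition steps :: "'e set \<Rightarrow> (real \<times> 'e) list \<Rightarrow> bool" where
  "steps E l \<longleftrightarrow> (\<forall>he\<in>set l. 0 < fst he \<and> snd he \<in> E)"

lemma positive_orthant_upd:
  "x \<in> positive_orthant E \<Longrightarrow> e \<in> E \<Longrightarrow> 0 < t \<Longrightarrow> x(e := t) \<in> positive_orthant E"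
  by (simp add: positive_orthant_def PiE_iff extensional_def)

lemma positive_orthant_shift:
  "x \<in> positive_orthant E \<Longrightarrow> e \<in> E \<Longrightarrow> 0 < h \<Longrightarrow> x(e := x e + h) \<in> positive_orthant E"
  by (rule positive_orthant_upd) (simp_all add: positive_orthant_def PiE_iff add_pos_pos)

lemma mixed_diff_scale: "mixed_diff l (\<lambda>x. c * f x) x = c * mixed_diff l f x"
  by (induction l arbitrary: f) (simp_all add: right_diff_distrib[symmetric])

text \<open>A mixed difference is a finite signed sum of values at points of the orthant, so
  linearity of the integral suffices.\<close>

lemma mixed_diff_has_integral:
  assumes "steps E l" "x \<in> positive_orthant E"
    and "\<And>x. x \<in> positive_orthant E \<Longrightarrow> ((\<lambda>t. w t * F t x) has_integral g x) UNIV"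
  shows "((\<lambda>t. w t * mixed_diff l (F t) x) has_integral mixed_diff l g x) UNIV"
  using assms
proof (induction l arbitrary: F g)
  case (Cons he l)
  have he: "0 < fst he" "snd he \<in> E" "steps E l" using Cons.prems(1) by (auto simp: steps_def)
  show ?case
    unfolding mixed_diff.simps
  proof (rule Cons.IH[OF he(3) Cons.prems(2)])
    fix x assume x: "x \<in> positive_orthant E"
    let ?y = "x(snd he := x (snd he) + fst he)"
    have "?y \<in> positive_orthant E" using x he by (intro positive_orthant_shift)
    then have "((\<lambda>t. w t * F t x - w t * F t ?y) has_integral g x - g ?y) UNIV"
      using x by (intro has_integral_diff Cons.prems(3))
    then show "((\<lambda>t. w t * (F t x - F t ?y)) has_integral g x - g ?y) UNIV"
      by (simp add: right_diff_distrib)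
  qed
qed auto

lemma mixture_mixed_diff_nonneg:
  assumes "mixture (positive_orthant E) G f" "steps E l" "x \<in> positive_orthant E"
    and G: "\<And>g. g \<in> G \<Longrightarrow> 0 \<le> mixed_diff l g x"
  shows "0 \<le> mixed_diff l f x"
  using assms(1)
proof induction
  case (int w F g)
  have "((\<lambda>t. w t * mixed_diff l (F t) x) has_integral mixed_diff l g x) UNIV"
    using assms(2,3) int.hyps(3) by (rule mixed_diff_has_integral)
  then show ?case
  proof (rule has_integral_nonneg)
    \<comment> \<open>Where the weight is 0 nothing is known about \<open>F t\<close>, but the
      product is 0.\<close>
    show "0 \<le> w t * mixed_diff l (F t) x" for t
      using int.IH[of t] int.hyps(2)[of t] by (cases "w t = 0") auto
  qed
qed (rule G)

text \<open>Shifting coordinate \<open>e\<close> by \<open>h\<close> scales the exponential by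
  \<open>exp (- (a e * h))\<close>, so a difference merely replaces \<open>c\<close> by the
  nonnegative \<open>c * (1 - exp (- (a e * h)))\<close>.\<close>

lemma mixed_diff_exp_nonneg:
  fixes a :: "'e \<Rightarrow> real"
  assumes "finite E" "\<And>e. e \<in> E \<Longrightarrow> 0 \<le> a e" "steps E l" "0 \<le> c"
  shows "0 \<le> mixed_diff l (\<lambda>x. c * exp (- (\<Sum>e\<in>E. a e * x e))) x"
  using assms(3,4)
proof (induction l arbitrary: c)
  case (Cons he l)
  obtain h e where he: "he = (h, e)" by (cases he)
  have h: "0 < h" "e \<in> E" "steps E l" using Cons.prems(1) by (auto simp: steps_def he)
  have shift: "(\<Sum>i\<in>E. a i * (x(e := x e + h)) i) = (\<Sum>i\<in>E. a i * x i) + a e * h" for x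
    using assms(1) h(2) by (simp add: sum.remove[of E e] distrib_left)
  have "(\<lambda>x. c * exp (- (\<Sum>i\<in>E. a i * x i)) - c * exp (- (\<Sum>i\<in>E. a i * (x(e := x e + h)) i))) =
      (\<lambda>x. (c * (1 - exp (- (a e * h)))) * exp (- (\<Sum>i\<in>E. a i * x i)))"
    unfolding shift by (simp add: fun_eq_iff exp_add exp_minus field_simps exp_diff)
  then have "mixed_diff (he # l) (\<lambda>x. c * exp (- (\<Sum>e\<in>E. a e * x e))) x =
      mixed_diff l (\<lambda>x. (c * (1 - exp (- (a e * h)))) * exp (- (\<Sum>i\<in>E. a i * x i))) x"
    by (simp add: he)
  also have "0 \<le> \<dots>"
    using h assms(2) Cons.prems(2) by (intro Cons.IH mult_nonneg_nonneg) auto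
  finally show ?case .
qed auto

lemma mixed_diff_tendsto:
  assumes "steps E l" "x \<in> positive_orthant E"
    and "\<And>x. x \<in> positive_orthant E \<Longrightarrow> ((\<lambda>h. F h x) \<longlongrightarrow> g x) A"
  shows "((\<lambda>h. mixed_diff l (F h) x) \<longlongrightarrow> mixed_diff l g x) A"
  using assms
proof (induction l arbitrary: F g)
  case (Cons he l)
  have he: "0 < fst he" "snd he \<in> E" "steps E l" using Cons.prems(1) by (auto simp: steps_def)
  show ?case
    unfolding mixed_diff.simps
    by (intro Cons.IH[OF he(3) Cons.prems(2)] tendsto_diff Cons.prems(3) positive_orthant_shift he)
qed auto

lemma completely_monotoneI_mixed_diff:
  assumes sm: "smooth_on_orthant E f"
    and nn: "\<And>l x. steps E l \<Longrightarrow> x \<in> positive_orthant E \<Longrightarrow> 0 \<le> mixed_diff l f x"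
  shows "completely_monotone E f"
proof -
  \<comment> \<open>Strengthened for induction on \<open>es\<close>: a derivative is a limit of
    difference quotients, so it can be traded for one more entry of \<open>l\<close>. The goal is
    the case \<open>l = []\<close>.\<close>
  have *: "0 \<le> (-1) ^ length es * mixed_diff l (iterated_partial es f) x"
    if "es \<in> lists E" "steps E l" "x \<in> positive_orthant E" for es l x
    using that
  proof (induction es arbitrary: l x)
    case (Cons e es)
    let ?g = "iterated_partial es f"
    \<comment> \<open>The forward difference quotient, written with the sign of
      \<open>mixed_diff\<close>. Steps are positive, hence the limit from the right below.\<close>
    let ?F = "\<lambda>h x. (- 1 / h) * (?g x - ?g (x(e := x e + h)))"
    have e: "e \<in> E" "es \<in> lists E" using Cons.hyps by auto
    have lim: "((\<lambda>h. ?F h x) \<longlongrightarrow> partial_deriv e ?g x) (at_right 0)"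
      if x: "x \<in> positive_orthant E" for x
    proof -
      have "(\<lambda>t. ?g (x(e := t))) differentiable at (x e)"
        using sm e x unfolding smooth_on_orthant_def by blast
      then have "((\<lambda>t. ?g (x(e := t))) has_real_derivative partial_deriv e ?g x) (at (x e))"
        unfolding partial_deriv_def by (simp add: DERIV_deriv_iff_real_differentiable)
      then have "((\<lambda>h. (?g (x(e := x e + h)) - ?g (x(e := x e))) / h) \<longlongrightarrow> partial_deriv e ?g x) (at 0)"
        unfolding DERIV_def .
      then have "((\<lambda>h. ?F h x) \<longlongrightarrow> partial_deriv e ?g x) (at 0)"
        by (rule Lim_transform_eventually) (auto simp: eventually_at_filter field_simps)
      then show ?thesis by (rule filterlim_mono) (auto simp: at_within_le_at)
    qed
    have "((\<lambda>h. (-1) ^ length (e # es) * mixed_diff l (?F h) x) \<longlongrightarrow>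
        (-1) ^ length (e # es) * mixed_diff l (partial_deriv e ?g) x) (at_right 0)"
      by (intro tendsto_mult_left mixed_diff_tendsto[OF Cons.prems(1,2)] lim)
    moreover have "\<forall>\<^sub>F h in at_right 0. 0 \<le> (-1) ^ length (e # es) * mixed_diff l (?F h) x"
      unfolding eventually_at_filter
    proof (intro always_eventually allI impI)
      fix h :: real assume "h \<in> {0<..}"
      then have h: "h > 0" by simp
      have "mixed_diff l (?F h) x = (- 1 / h) * mixed_diff ((h, e) # l) ?g x"
        by (simp add: mixed_diff_scale[symmetric])
      then have "(-1) ^ length (e # es) * mixed_diff l (?F h) x =
          (1 / h) * ((-1) ^ length es * mixed_diff ((h, e) # l) ?g x)" by simp
      also have "\<dots> \<ge> 0"
        using h e Cons.prems by (intro mult_nonneg_nonneg Cons.IH) (auto simp: steps_def)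
      finally show "0 \<le> (-1) ^ length (e # es) * mixed_diff l (?F h) x" .
    qed
    ultimately show ?case
      by (simp only: iterated_partial.simps) (rule tendsto_lowerbound, auto)
  qed (use nn in auto)
  have "0 \<le> (-1) ^ length es * iterated_partial es f x" if "es \<in> lists E" "x \<in> positive_orthant E" for es x
    using *[of es "[]" x] that by (simp add: steps_def)
  with sm show ?thesis by (simp add: completely_monotone_def)
qed

section \<open>Smoothness\<close>

text \<open>A class closed under partial derivatives that contains the real powers of polynomials
  positive on the orthant.\<close>

inductive elementary :: "'e set \<Rightarrow> (('e \<Rightarrow> real) \<Rightarrow> real) \<Rightarrow> bool" for E where
  const: "elementary E (\<lambda>x. c)"
| coord: "e \<in> E \<Longrightarrow> elementary E (\<lambda>x. x e)"
| add: "elementary E f \<Longrightarrow> elementary E g \<Longrightarrow> elementary E (\<lambda>x. f x + g x)"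
| mult: "elementary E f \<Longrightarrow> elementary E g \<Longrightarrow> elementary E (\<lambda>x. f x * g x)"
| powr: "elementary E f \<Longrightarrow> (\<And>x. x \<in> positive_orthant E \<Longrightarrow> 0 < f x) \<Longrightarrow>
    elementary E (\<lambda>x. f x powr c)"

lemma elementary_sum: "(\<And>i. i \<in> I \<Longrightarrow> elementary E (f i)) \<Longrightarrow> elementary E (\<lambda>x. \<Sum>i\<in>I. f i x)"
  by (induction I rule: infinite_finite_induct) (simp_all add: elementary.const elementary.add)

lemma elementary_prod: "(\<And>i. i \<in> I \<Longrightarrow> elementary E (f i)) \<Longrightarrow> elementary E (\<lambda>x. \<Prod>i\<in>I. f i x)"
  by (induction I rule: infinite_finite_induct) (simp_all add: elementary.const elementary.mult)

lemma elementary_continuous: "elementary E f \<Longrightarrow> continuous_on (positive_orthant E) f"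
proof (induction rule: elementary.induct)
  case (coord e)
  show ?case by (intro continuous_on_product_coordinates continuous_on_subset[OF _ subset_UNIV])
next
  case (powr f c)
  then show ?case by (intro continuous_on_powr continuous_on_const) force+
qed (auto intro!: continuous_intros)

lemma elementary_deriv:
  assumes "elementary E f" "e \<in> E"
  shows "\<exists>f'. elementary E f' \<and>
    (\<forall>x\<in>positive_orthant E. ((\<lambda>t. f (x(e := t))) has_real_derivative f' x) (at (x e)))"
  using assms(1)
proof induction
  case (const c)
  show ?case by (intro exI[of _ "\<lambda>x. 0"]) (auto intro: elementary.const)
next
  case (coord i)
  show ?case
    by (intro exI[of _ "\<lambda>x. of_bool (i = e)"]) (auto intro: elementary.const)
next
  case (add f g)
  then obtain f' g' where "elementary E f'" "elementary E g'"
    "\<forall>x\<in>positive_orthant E. ((\<lambda>t. f (x(e := t))) has_real_derivative f' x) (at (x e))"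
    "\<forall>x\<in>positive_orthant E. ((\<lambda>t. g (x(e := t))) has_real_derivative g' x) (at (x e))" by blast
  then show ?case
    by (intro exI[of _ "\<lambda>x. f' x + g' x"] conjI ballI elementary.add DERIV_add) blast+
next
  case (mult f g)
  then obtain f' g' where "elementary E f'" "elementary E g'"
    "\<forall>x\<in>positive_orthant E. ((\<lambda>t. f (x(e := t))) has_real_derivative f' x) (at (x e))"
    "\<forall>x\<in>positive_orthant E. ((\<lambda>t. g (x(e := t))) has_real_derivative g' x) (at (x e))" by blast
  then show ?case using mult.hyps
    by (intro exI[of _ "\<lambda>x. f' x * g x + g' x * f x"] conjI ballI elementary.add elementary.mult
        DERIV_mult[THEN DERIV_cong]) (assumption | blast | simp)+
next
  case (powr f c)
  then obtain f' where f': "elementary E f'"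
    "\<forall>x\<in>positive_orthant E. ((\<lambda>t. f (x(e := t))) has_real_derivative f' x) (at (x e))" by blast
  show ?case
  proof (intro exI[of _ "\<lambda>x. c * (f x powr (c - 1) * f' x)"] conjI ballI)
    show "elementary E (\<lambda>x. c * (f x powr (c - 1) * f' x))"
      by (intro elementary.mult elementary.const f' elementary.powr powr.hyps)
    fix x assume x: "x \<in> positive_orthant E"
    then show "((\<lambda>t. f (x(e := t)) powr c) has_real_derivative c * (f x powr (c - 1) * f' x)) (at (x e))"
      using DERIV_fun_powr[of "\<lambda>t. f (x(e := t))" "f' x" "x e" c] f'(2) powr.hyps(2)
      by (simp add: mult_ac)
  qed
qed

lemma elementary_iterated_partial:
  assumes "elementary E f" "es \<in> lists E"
  shows "\<exists>g. elementary E g \<and> (\<forall>x\<in>positive_orthant E. iterated_partial es f x = g x)"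
    and "e \<in> E \<Longrightarrow> x \<in> positive_orthant E \<Longrightarrow>
      (\<lambda>t. iterated_partial es f (x(e := t))) differentiable at (x e)"
proof -
  \<comment> \<open>\<open>deriv\<close> depends only on values near \<open>x e\<close>; agreement
    on the orthant is enough because \<open>{0<..}\<close> is open.\<close>
  have D: "((\<lambda>t. h (x(e := t))) has_real_derivative d) (at (x e))"
    if "\<forall>x\<in>positive_orthant E. h x = g x" "((\<lambda>t. g (x(e := t))) has_real_derivative d) (at (x e))"
      "e \<in> E" "x \<in> positive_orthant E" for g h :: "('a \<Rightarrow> real) \<Rightarrow> real" and d x e
    using that(2)
  proof (rule has_field_derivative_transform_within_open[where S = "{0<..}"])
    show "x e \<in> {0<..}" using that(3,4) by (auto simp: positive_orthant_def)
    fix t :: real assume "t \<in> {0<..}"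
    then show "g (x(e := t)) = h (x(e := t))"
      using that(1,3,4) positive_orthant_upd by (metis greaterThan_iff)
  qed simp
  show ex: "\<exists>g. elementary E g \<and> (\<forall>x\<in>positive_orthant E. iterated_partial es f x = g x)"
    using assms(2)
  proof induction
    case Nil
    with assms(1) show ?case by auto
  next
    case (Cons e es)
    then obtain g where g: "elementary E g" "\<forall>x\<in>positive_orthant E. iterated_partial es f x = g x"
      by blast
    obtain g' where g': "elementary E g'"
      "\<forall>x\<in>positive_orthant E. ((\<lambda>t. g (x(e := t))) has_real_derivative g' x) (at (x e))"
      using elementary_deriv[OF g(1) Cons.hyps(1)] by blast
    have "iterated_partial (e # es) f x = g' x" if "x \<in> positive_orthant E" for x
      using D[OF g(2) _ Cons.hyps(1) that] g'(2) that
      by (auto simp: partial_deriv_def intro: DERIV_imp_deriv)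
    with g'(1) show ?case by blast
  qed
  assume e: "e \<in> E" and x: "x \<in> positive_orthant E"
  from ex obtain g where g: "elementary E g" "\<forall>x\<in>positive_orthant E. iterated_partial es f x = g x"
    by blast
  obtain g' where
    "\<forall>x\<in>positive_orthant E. ((\<lambda>t. g (x(e := t))) has_real_derivative g' x) (at (x e))"
    using elementary_deriv[OF g(1) e] by blast
  then show "(\<lambda>t. iterated_partial es f (x(e := t))) differentiable at (x e)"
    using D[OF g(2) _ e x] x by (auto simp: real_differentiable_def)
qed

lemma elementary_smooth:
  assumes "elementary E f"
  shows "smooth_on_orthant E f"
  unfolding smooth_on_orthant_def
proof (intro ballI conjI)
  fix es assume es: "es \<in> lists E"
  obtain g where "elementary E g" "\<forall>x\<in>positive_orthant E. iterated_partial es f x = g x"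
    using elementary_iterated_partial(1)[OF assms es] by blast
  then show "continuous_on (positive_orthant E) (iterated_partial es f)"
    using elementary_continuous by (metis continuous_on_cong)
  show "\<And>e x. e \<in> E \<Longrightarrow> x \<in> positive_orthant E \<Longrightarrow>
      (\<lambda>t. iterated_partial es f (x(e := t))) differentiable at (x e)"
    by (rule elementary_iterated_partial(2)[OF assms es])
qed

section \<open>Euclidean edge weights\<close>

text \<open>Gram--Schmidt: the projections orthogonal to \<open>p x\<close> need one coordinate less.\<close>

lemma gram_coordinates:
  fixes p :: "'u \<Rightarrow> nat \<Rightarrow> real"
  assumes "finite S"
  shows "\<exists>g. \<forall>u\<in>S. \<forall>w\<in>S. (\<Sum>j<D. p u j * p w j) = (\<Sum>j<card S. g u j * (g w j :: real))"
  using assms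
proof (induction S arbitrary: p)
  case (insert x S)
  define ip where "ip p u w = (\<Sum>j<D. p u j * p w j)" for p :: "'u \<Rightarrow> nat \<Rightarrow> real" and u w
  have ip_sym: "ip p u w = ip p w u" for p u w by (simp add: ip_def mult.commute)
  define r where "r = sqrt (ip p x x)"
  have "ip p x x \<ge> 0" by (auto simp: ip_def intro: sum_nonneg)
  then have r2: "r * r = ip p x x" by (simp add: r_def)
  have zero: "ip p x u = 0" if "r = 0" for u
  proof -
    have "(\<Sum>j<D. p x j * p x j) = 0" using r2 that by (simp add: ip_def)
    then have "p x j = 0" if "j < D" for j
      using that by (subst (asm) sum_nonneg_eq_0_iff) auto
    then show ?thesis by (simp add: ip_def)
  qed
  \<comment> \<open>The component orthogonal to \<open>p x\<close>. For \<open>r = 0\<close> the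
    division yields 0 and \<open>p'\<close> is \<open>p\<close>, which is right since by
    \<open>zero\<close> all products with \<open>p x\<close> vanish.\<close>
  define p' where "p' u j = p u j - ip p x u / (r * r) * p x j" for u j
  have ip': "ip p' u w = ip p u w - ip p x u / r * (ip p x w / r)" for u w
  proof -
    have "ip p' u w = (\<Sum>j<D. p u j * p w j - ip p x w / (r * r) * (p x j * p u j)
        - ip p x u / (r * r) * (p x j * p w j)
        + ip p x u / (r * r) * (ip p x w / (r * r)) * (p x j * p x j))"
      unfolding ip_def[of p'] p'_def by (intro sum.cong) (auto simp: algebra_simps)
    also have "\<dots> = ip p u w - ip p x w / (r * r) * ip p x u - ip p x u / (r * r) * ip p x w
        + ip p x u / (r * r) * (ip p x w / (r * r)) * ip p x x"
      unfolding ip_def by (simp add: sum.distrib sum_subtractf sum_distrib_left)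
    also have "\<dots> = ip p u w - ip p x u / r * (ip p x w / r)"
      unfolding r2[symmetric] by (cases "r = 0") (auto simp: field_simps)
    finally show ?thesis .
  qed
  obtain g where g: "\<forall>u\<in>S. \<forall>w\<in>S. ip p' u w = (\<Sum>j<card S. g u j * g w j)"
    using insert.IH[of p'] unfolding ip_def by blast
  \<comment> \<open>The last coordinate, of index \<open>card S\<close>, records the component along
    \<open>p x\<close>; the point \<open>x\<close> has no other.\<close>
  define h where "h u j = (if j = card S then ip p x u / r else if u = x then 0 else g u j)" for u j
  have sum_h: "(\<Sum>j<card (insert x S). h u j * h w j) =
      (if u = x \<or> w = x then 0 else (\<Sum>j<card S. g u j * g w j)) + ip p x u / r * (ip p x w / r)" for u w
    using insert.hyps by (simp add: h_def)
  have "ip p u w = (\<Sum>j<card (insert x S). h u j * h w j)"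
    if uw: "u \<in> insert x S" "w \<in> insert x S" for u w
  proof (cases "u = x \<or> w = x")
    case True
    have xx: "ip p x y = ip p x x / r * (ip p x y / r)" for y
      using zero[of y] r2 by (cases "r = 0") (auto simp: field_simps)
    from True show ?thesis
      unfolding sum_h using xx[of u] xx[of w] ip_sym[of p u x] by (auto simp: mult.commute)
  next
    case False
    then have "ip p' u w = (\<Sum>j<card S. g u j * g w j)" using uw g by auto
    then show ?thesis unfolding sum_h using False ip'[of u w] by simp
  qed
  then show ?case unfolding ip_def by blast
qed auto

text \<open>Squared distances add up over coordinates, so that Gaussian integrals factor. The
  dimension is left open and reduced by \<open>euclidean_on_dim\<close>.\<close>

definition euclidean_on :: "'a set \<Rightarrow> ('a set \<Rightarrow> real) \<Rightarrow> bool" where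
  "euclidean_on C a \<longleftrightarrow>
     (\<exists>(D :: nat) p. \<forall>u\<in>C. \<forall>w\<in>C. u \<noteq> w \<longrightarrow> a {u, w} = (\<Sum>j<D. (p u j - p w j :: real)\<^sup>2))"

text \<open>Moving one point to the origin leaves \<open>card C - 1\<close> vectors. Their Gram
  matrix determines all distances, and \<open>gram_coordinates\<close> realizes it in as many
  coordinates as there are vectors.\<close>

lemma euclidean_on_dim:
  assumes C: "finite C" "C \<noteq> {}" and a: "euclidean_on C a"
  obtains q :: "'a \<Rightarrow> nat \<Rightarrow> real" where
    "\<And>u w. u \<in> C \<Longrightarrow> w \<in> C \<Longrightarrow> u \<noteq> w \<Longrightarrow> a {u, w} = (\<Sum>j<card C - 1. (q u j - q w j)\<^sup>2)"
proof -
  obtain D :: nat and p :: "'a \<Rightarrow> nat \<Rightarrow> real" where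
    p: "\<And>u w. u \<in> C \<Longrightarrow> w \<in> C \<Longrightarrow> u \<noteq> w \<Longrightarrow> a {u, w} = (\<Sum>j<D. (p u j - p w j)\<^sup>2)"
    using a unfolding euclidean_on_def by blast
  obtain z where z: "z \<in> C" using C by blast
  define P where "P u j = p u j - p z j" for u j
  obtain g where g: "\<forall>u\<in>C - {z}. \<forall>w\<in>C - {z}.
      (\<Sum>j<D. P u j * P w j) = (\<Sum>j<card (C - {z}). g u j * g w j)"
    using gram_coordinates[where S = "C - {z}" and D = D and p = P] C by auto
  define q where "q u j = (if u = z then 0 else g u j)" for u j
  have ip: "(\<Sum>j<card C - 1. q u j * q w j) = (\<Sum>j<D. P u j * P w j)" if "u \<in> C" "w \<in> C" for u w
  proof (cases "u = z \<or> w = z")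
    case True
    then show ?thesis by (auto simp: q_def P_def)
  next
    case False
    then show ?thesis using g that z by (simp add: q_def)
  qed
  have sq: "(\<Sum>j<n. (f u j - f w j)\<^sup>2) =
      (\<Sum>j<n. f u j * f u j) - 2 * (\<Sum>j<n. f u j * f w j) + (\<Sum>j<n. f w j * f w j)"
    for f :: "'a \<Rightarrow> nat \<Rightarrow> real" and u w and n :: nat
    by (simp add: sum.distrib[symmetric] sum_subtractf[symmetric] sum_distrib_left power2_eq_square algebra_simps)
  show thesis
  proof (rule that)
    fix u w assume uw: "u \<in> C" "w \<in> C" "u \<noteq> w"
    have "a {u, w} = (\<Sum>j<D. (P u j - P w j)\<^sup>2)" using p[OF uw] by (simp add: P_def)
    also have "\<dots> = (\<Sum>j<card C - 1. (q u j - q w j)\<^sup>2)"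
      unfolding sq using uw by (simp only: ip)
    finally show "a {u, w} = (\<Sum>j<card C - 1. (q u j - q w j)\<^sup>2)" .
  qed
qed

definition clique :: "'a set set \<Rightarrow> 'a set \<Rightarrow> bool" where
  "clique E C \<longleftrightarrow> (\<forall>u\<in>C. \<forall>w\<in>C. u \<noteq> w \<longrightarrow> {u, w} \<in> E)"

text \<open>Different cliques may use unrelated placements, so a restored vertex is placed with
  respect to its neighbours alone.\<close>

definition euclidean :: "'a set set \<Rightarrow> ('a set \<Rightarrow> real) \<Rightarrow> bool" where
  "euclidean E a \<longleftrightarrow> (\<forall>C. clique E C \<longrightarrow> euclidean_on C a)"

definition exp_gens :: "'a set set \<Rightarrow> (('a set \<Rightarrow> real) \<Rightarrow> real) set" where
  "exp_gens E = {\<lambda>x. exp (- (\<Sum>e\<in>E. a e * x e)) | a. euclidean E a}"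

text \<open>An edge is a clique of two points, so its coefficient is a sum of squares.\<close>

lemma euclidean_nonneg:
  assumes "euclidean E a" "e \<in> E" "card e = 2"
  shows "0 \<le> a e"
proof -
  obtain u w where uw: "e = {u, w}" "u \<noteq> w" using assms(3) by (auto simp: card_2_iff)
  then have "clique E e" using assms(2) by (auto simp: clique_def insert_commute)
  then have "euclidean_on e a" using assms(1) by (simp add: euclidean_def)
  then obtain D :: nat and p :: "'a \<Rightarrow> nat \<Rightarrow> real" where "a {u, w} = (\<Sum>j<D. (p u j - p w j)\<^sup>2)"
    using uw unfolding euclidean_on_def by blast
  then show ?thesis using uw by (auto intro: sum_nonneg)
qed

section \<open>Sums over pairs, and the mixture that restores a vertex\<close>

lemma sum_over_pairs:
  fixes f :: "'a set \<Rightarrow> real"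
  assumes "finite N"
  shows "(\<Sum>u\<in>N. \<Sum>w\<in>N - {u}. f {u, w}) = 2 * (\<Sum>e | e \<subseteq> N \<and> card e = 2. f e)"
  using assms
proof (induction N)
  case empty
  have no: "{e. e = {} \<and> card e = 2} = ({} :: 'a set set)" by auto
  show ?case by (simp add: no)
next
  case (insert x N)
  let ?P = "\<lambda>N. {e. e \<subseteq> N \<and> card e = 2}"
  have split: "?P (insert x N) = ?P N \<union> (\<lambda>u. {x, u}) ` N"
  proof (intro equalityI subsetI)
    fix e assume e: "e \<in> ?P (insert x N)"
    then obtain a b where "e = {a, b}" "a \<noteq> b" by (auto simp: card_2_iff)
    with e show "e \<in> ?P N \<union> (\<lambda>u. {x, u}) ` N" by (auto simp: insert_commute)
  next
    fix e assume "e \<in> ?P N \<union> (\<lambda>u. {x, u}) ` N"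
    then show "e \<in> ?P (insert x N)" using insert.hyps by (auto simp: card_2_iff)
  qed
  have "(\<Sum>e\<in>?P (insert x N). f e) = (\<Sum>e\<in>?P N. f e) + (\<Sum>e\<in>(\<lambda>u. {x, u}) ` N. f e)"
    unfolding split using insert.hyps by (intro sum.union_disjoint) auto
  also have "(\<Sum>e\<in>(\<lambda>u. {x, u}) ` N. f e) = (\<Sum>u\<in>N. f {x, u})"
    by (subst sum.reindex) (auto simp: inj_on_def doubleton_eq_iff)
  finally have R: "(\<Sum>e\<in>?P (insert x N). f e) = (\<Sum>e\<in>?P N. f e) + (\<Sum>u\<in>N. f {x, u})" .
  have in1: "insert x N - {u} = insert x (N - {u})" if "u \<in> N" for u using that insert.hyps by auto
  have "(\<Sum>u\<in>insert x N. \<Sum>w\<in>insert x N - {u}. f {u, w}) =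
     (\<Sum>w\<in>N. f {x, w}) + (\<Sum>u\<in>N. f {u, x} + (\<Sum>w\<in>N - {u}. f {u, w}))"
    using insert.hyps by (simp add: in1 cong: sum.cong)
  also have "\<dots> = 2 * (\<Sum>w\<in>N. f {x, w}) + (\<Sum>u\<in>N. \<Sum>w\<in>N - {u}. f {u, w})"
    by (simp add: sum.distrib insert_commute)
  finally show ?case using insert.IH R by simp
qed

text \<open>Lagrange's identity. It matches the remainder of the completed square with the pair
  products of the star-mesh transform.\<close>

lemma sum_square_differences:
  fixes y q :: "'u \<Rightarrow> real"
  shows "(\<Sum>u\<in>N. \<Sum>w\<in>N. y u * y w * (q u - q w)\<^sup>2) =
    2 * ((\<Sum>u\<in>N. y u) * (\<Sum>u\<in>N. y u * (q u)\<^sup>2) - (\<Sum>u\<in>N. y u * q u)\<^sup>2)"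
proof -
  have "(\<Sum>u\<in>N. \<Sum>w\<in>N. y u * y w * (q u - q w)\<^sup>2) =
     (\<Sum>u\<in>N. \<Sum>w\<in>N. (y u * (q u)\<^sup>2) * y w + y u * (y w * (q w)\<^sup>2) - 2 * ((y u * q u) * (y w * q w)))"
    by (intro sum.cong refl) (simp add: power2_eq_square algebra_simps)
  also have "\<dots> = (\<Sum>u\<in>N. y u * (q u)\<^sup>2) * (\<Sum>u\<in>N. y u) + (\<Sum>u\<in>N. y u) * (\<Sum>u\<in>N. y u * (q u)\<^sup>2)
      - 2 * ((\<Sum>u\<in>N. y u * q u) * (\<Sum>u\<in>N. y u * q u))"
    by (simp only: sum.distrib sum_subtractf sum_distrib_left[symmetric] sum_distrib_right[symmetric])
  finally show ?thesis by (simp add: power2_eq_square algebra_simps)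
qed

text \<open>The vertex \<open>v\<close> is placed at a point \<open>p\<close> of the \<open>(card N - 1)\<close>-dimensional space that
  contains its neighbours, raised by \<open>sqrt t\<close> in a new direction. Integrating \<open>p\<close> with respect
  to Lebesgue measure and \<open>t\<close> with a Gamma density produces the star-mesh transform.\<close>

lemma mixture_eliminate:
  assumes G: "simple_graph V E" and N: "nbrs E v \<noteq> {}"
    and \<beta>: "(real (card (nbrs E v)) - 1) / 2 < \<beta>" and a: "euclidean (elim_edges E v) a"
  shows "mixture (positive_orthant E) (exp_gens E)
    (\<lambda>x. star_weight E v x powr (- \<beta>) * exp (- (\<Sum>e\<in>elim_edges E v. a e * star_mesh E v x e)))"
proof -
  let ?N = "nbrs E v" and ?D = "positive_orthant E"
  let ?s = "star_weight E v"
  let ?E0 = "{e \<in> E. v \<notin> e}"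
  let ?P = "{e. e \<subseteq> ?N \<and> card e = 2}"
  define d where "d = card ?N - 1"
  define \<gamma> where "\<gamma> = \<beta> - real d / 2"
  define y where "y x u = x {u, v}" for x :: "'a set \<Rightarrow> real" and u
  have finV: "finite V" using G by (simp add: simple_graph_def)
  have NV: "?N \<subseteq> V" "v \<notin> ?N"
    using simple_graphD[OF G] simple_graphD[OF G, of v v] by (auto simp: nbrs_def)
  have finN: "finite ?N" using finV NV finite_subset by blast
  have "E \<subseteq> Pow V" using G by (auto simp: simple_graph_def)
  then have finE: "finite E" using finV finite_subset by blast
  have card1: "card ?N \<ge> 1" using N finN by (simp add: Suc_le_eq card_gt_0_iff)
  have \<gamma>: "\<gamma> > 0" using \<beta> card1 by (simp add: \<gamma>_def d_def of_nat_diff)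
  have s_y: "?s x = (\<Sum>u\<in>?N. y x u)" for x by (simp add: star_weight_def y_def)
  have s_pos: "?s x > 0" if "x \<in> ?D" for x
    unfolding s_y y_def using N finN that
    by (intro sum_pos) (auto simp: positive_orthant_def nbrs_def)
  have "clique (elim_edges E v) ?N"
    by (auto simp: clique_def elim_edges_def)
  then have "euclidean_on ?N a" using a by (simp add: euclidean_def)
  then obtain q :: "'a \<Rightarrow> nat \<Rightarrow> real" where
    q: "\<And>u w. u \<in> ?N \<Longrightarrow> w \<in> ?N \<Longrightarrow> u \<noteq> w \<Longrightarrow> a {u, w} = (\<Sum>j<d. (q u j - q w j)\<^sup>2)"
    using euclidean_on_dim[OF finN N] unfolding d_def by blast
  define R0 where "R0 x = exp (- (\<Sum>e\<in>?E0. a e * x e))" for x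
  define Q where "Q x j = (\<Sum>u\<in>?N. y x u * (q u j)\<^sup>2) - (\<Sum>u\<in>?N. y x u * q u j)\<^sup>2 / (\<Sum>u\<in>?N. y x u)"
    for x j
  have splitE: "E = ?E0 \<union> (\<lambda>u. {u, v}) ` ?N"
  proof (intro equalityI subsetI)
    fix e assume e: "e \<in> E"
    then have "card e = 2" using G by (simp add: simple_graph_def)
    then obtain u w where "e = {u, w}" by (auto simp: card_2_iff)
    with e show "e \<in> ?E0 \<union> (\<lambda>u. {u, v}) ` ?N"
      by (auto simp: nbrs_def image_iff insert_commute)
  qed (auto simp: nbrs_def)
  have base: "mixture ?D (exp_gens E)
      (\<lambda>x. (R0 x * exp (- t * ?s x)) * exp (- (\<Sum>j<d. \<Sum>u\<in>?N. y x u * (q u j - p j)\<^sup>2)))"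
    if t: "t \<ge> 0" for t p
  proof -
    \<comment> \<open>Coefficients on the larger graph. At an edge \<open>{u, v}\<close> the sum has
      the single index \<open>u\<close> and gives the squared distance from \<open>q u\<close> to
      the raised point; other edges keep \<open>a\<close>.\<close>
    define b where "b e = (if v \<in> e then \<Sum>u\<in>e - {v}. (\<Sum>j<d. (q u j - p j)\<^sup>2) + t else a e)" for e
    have b_v: "b {u, v} = (\<Sum>j<d. (q u j - p j)\<^sup>2) + t" if "u \<noteq> v" for u
    proof -
      have "{u, v} - {v} = {u}" using that by auto
      then show ?thesis by (simp add: b_def)
    qed
    have "euclidean E b" unfolding euclidean_def
    proof (intro allI impI)
      fix C assume C: "clique E C"
      show "euclidean_on C b"
      proof (cases "v \<in> C")
        case False
        then have "clique (elim_edges E v) C"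
          using C by (auto simp: clique_def elim_edges_def)
        then have "euclidean_on C a" using a by (simp add: euclidean_def)
        moreover have "b {u, w} = a {u, w}" if "u \<in> C" "w \<in> C" for u w
          using False that by (auto simp: b_def)
        ultimately show ?thesis unfolding euclidean_on_def by metis
      next
        case True
        have CN: "u \<in> ?N" if "u \<in> C" "u \<noteq> v" for u
          using C True that by (auto simp: clique_def nbrs_def)
        \<comment> \<open>Coordinate \<open>d\<close> is the new direction: \<open>v\<close> has
          height \<open>sqrt t\<close> there, its neighbours height 0.\<close>
        define P where "P u j = (if u = v then if j = d then sqrt t else p j
          else if j = d then 0 else q u j)" for u j
        have "b {u, w} = (\<Sum>j<Suc d. (P u j - P w j)\<^sup>2)" if uw: "u \<in> C" "w \<in> C" "u \<noteq> w" for u w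
        proof -
          consider "u = v" "w \<noteq> v" | "w = v" "u \<noteq> v" | "u \<noteq> v" "w \<noteq> v" using uw by blast
          then show ?thesis
          proof cases
            case 1
            then have "b {u, w} = (\<Sum>j<d. (q w j - p j)\<^sup>2) + t" using b_v[of w] by (simp add: insert_commute)
            then show ?thesis using 1 t by (simp add: P_def power2_commute)
          next
            case 2
            then show ?thesis using b_v[of u] t by (simp add: P_def)
          next
            case 3
            then have "b {u, w} = a {u, w}" by (simp add: b_def)
            then show ?thesis using q[of u w] CN uw 3 by (simp add: P_def)
          qed
        qed
        then show ?thesis unfolding euclidean_on_def by blast
      qed
    qed
    then have "mixture ?D (exp_gens E) (\<lambda>x. exp (- (\<Sum>e\<in>E. b e * x e)))"
      by (intro mixture.gen) (auto simp: exp_gens_def)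
    then show ?thesis
    proof (rule mixture_cong)
      fix x :: "'a set \<Rightarrow> real"
      have "(\<Sum>e\<in>E. b e * x e) = (\<Sum>e\<in>?E0. b e * x e) + (\<Sum>e\<in>(\<lambda>u. {u, v}) ` ?N. b e * x e)"
        by (subst splitE, rule sum.union_disjoint) (use finE finN in auto)
      also have "(\<Sum>e\<in>?E0. b e * x e) = (\<Sum>e\<in>?E0. a e * x e)"
        by (intro sum.cong) (auto simp: b_def)
      also have "(\<Sum>e\<in>(\<lambda>u. {u, v}) ` ?N. b e * x e) = (\<Sum>u\<in>?N. b {u, v} * x {u, v})"
        by (subst sum.reindex) (auto simp: inj_on_def doubleton_eq_iff)
      also have "\<dots> = (\<Sum>u\<in>?N. (\<Sum>j<d. y x u * (q u j - p j)\<^sup>2) + t * y x u)"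
      proof (intro sum.cong refl)
        fix u assume "u \<in> ?N"
        then have "u \<noteq> v" using NV by auto
        then show "b {u, v} * x {u, v} = (\<Sum>j<d. y x u * (q u j - p j)\<^sup>2) + t * y x u"
          by (simp add: b_v y_def sum_distrib_left algebra_simps)
      qed
      also have "\<dots> = (\<Sum>j<d. \<Sum>u\<in>?N. y x u * (q u j - p j)\<^sup>2) + t * ?s x"
        unfolding s_y sum.distrib sum_distrib_left by (subst sum.swap) simp
      finally show "R0 x * exp (- t * ?s x) * exp (- (\<Sum>j<d. \<Sum>u\<in>?N. y x u * (q u j - p j)\<^sup>2)) =
          exp (- (\<Sum>e\<in>E. b e * x e))"
        unfolding R0_def exp_add[symmetric] by simp
    qed
  qed
  have "mixture ?D (exp_gens E)
      (\<lambda>x. (R0 x * exp (- t * ?s x)) * (?s x powr (- real d / 2) * exp (- (\<Sum>j<d. Q x j))))"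
    if "t \<ge> 0" for t
    unfolding Q_def s_y
    by (rule mixture_gauss_multi) (use base[OF that] s_pos in \<open>auto simp: s_y\<close>)
  then have "mixture ?D (exp_gens E)
      (\<lambda>x. (R0 x * (?s x powr (- real d / 2) * exp (- (\<Sum>j<d. Q x j)))) * exp (- t * ?s x))"
    if "t \<ge> 0" for t using that by (simp only: mult_ac)
  from mixture_gamma[OF this s_pos \<gamma>] show ?thesis
  proof (rule mixture_cong)
    fix x assume x: "x \<in> ?D"
    have s: "?s x > 0" using x by (rule s_pos)
    have finE': "finite (elim_edges E v)"
      unfolding elim_edges_def using finE finN by simp
    have "(\<Sum>e\<in>elim_edges E v. a e * star_mesh E v x e) =
      (\<Sum>e\<in>elim_edges E v. a e * (if e \<in> E then x e else 0)) +
      (\<Sum>e\<in>elim_edges E v. a e * (if e \<subseteq> ?N then (\<Prod>u\<in>e. x {u, v}) / ?s x else 0))"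
      unfolding star_mesh_def by (simp add: distrib_left sum.distrib)
    also have "(\<Sum>e\<in>elim_edges E v. a e * (if e \<in> E then x e else 0)) = (\<Sum>e\<in>?E0. a e * x e)"
      using finE' NV by (intro sum.mono_neutral_cong_right) (auto simp: elim_edges_def)
    also have "(\<Sum>e\<in>elim_edges E v. a e * (if e \<subseteq> ?N then (\<Prod>u\<in>e. x {u, v}) / ?s x else 0)) =
        (\<Sum>e\<in>?P. a e * (\<Prod>u\<in>e. y x u) / ?s x)"
      using finE' G by (intro sum.mono_neutral_cong_right) (auto simp: elim_edges_def y_def simple_graph_def)
    \<comment> \<open>Coordinate by coordinate, the pair sum divided by the total weight is the
      exponent left over by the Gaussian integral.\<close>
    also have "\<dots> = (\<Sum>j<d. Q x j)"
    proof -
      have "2 * (\<Sum>e\<in>?P. a e * (\<Prod>u\<in>e. y x u)) =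
          (\<Sum>u\<in>?N. \<Sum>w\<in>?N - {u}. a {u, w} * (\<Prod>u\<in>{u, w}. y x u))"
        by (rule sum_over_pairs[OF finN, symmetric])
      also have "\<dots> = (\<Sum>u\<in>?N. \<Sum>w\<in>?N - {u}. \<Sum>j<d. y x u * y x w * (q u j - q w j)\<^sup>2)"
        by (intro sum.cong refl) (auto simp: q sum_distrib_left mult_ac)
      also have "\<dots> = (\<Sum>u\<in>?N. \<Sum>w\<in>?N. \<Sum>j<d. y x u * y x w * (q u j - q w j)\<^sup>2)"
        using finN by (intro sum.cong refl sum.mono_neutral_left) auto
      also have "\<dots> = (\<Sum>u\<in>?N. \<Sum>j<d. \<Sum>w\<in>?N. y x u * y x w * (q u j - q w j)\<^sup>2)"
        by (intro sum.cong refl sum.swap)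
      also have "\<dots> = (\<Sum>j<d. \<Sum>u\<in>?N. \<Sum>w\<in>?N. y x u * y x w * (q u j - q w j)\<^sup>2)"
        by (rule sum.swap)
      also have "\<dots> = (\<Sum>j<d. 2 * (?s x * Q x j))"
        unfolding sum_square_differences using s
        by (intro sum.cong refl) (simp add: s_y Q_def field_simps)
      finally have "(\<Sum>e\<in>?P. a e * (\<Prod>u\<in>e. y x u)) = ?s x * (\<Sum>j<d. Q x j)"
        by (simp add: sum_distrib_left[symmetric])
      then show ?thesis using s by (simp add: sum_divide_distrib[symmetric])
    qed
    finally have "exp (- (\<Sum>e\<in>elim_edges E v. a e * star_mesh E v x e)) = R0 x * exp (- (\<Sum>j<d. Q x j))"
      unfolding R0_def exp_add[symmetric] by simp
    moreover have "?s x powr (- \<beta>) = ?s x powr (- real d / 2) * ?s x powr (- \<gamma>)"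
      unfolding powr_add[symmetric] \<gamma>_def by simp
    ultimately show "?s x powr (- \<beta>) * exp (- (\<Sum>e\<in>elim_edges E v. a e * star_mesh E v x e)) =
        R0 x * (?s x powr (- real d / 2) * exp (- (\<Sum>j<d. Q x j))) * ?s x powr (- \<gamma>)"
      by (simp only: mult_ac)
  qed
qed

section \<open>Tree decompositions\<close>

text \<open>\<open>h\<close> is a retraction onto \<open>V'\<close> that maps each edge to an edge
  or to a point, so it carries paths to paths. It serves for removing a leaf and for eliminating a
  vertex.\<close>

lemma connected_graph_map:
  assumes con: "connected_graph V E" and simple: "simple_graph V' E'" and V': "V' \<subseteq> V" "V' \<noteq> {}"
    and h: "\<And>x. x \<in> V' \<Longrightarrow> h x = x" "\<And>x y. {x, y} \<in> E \<Longrightarrow> h x = h y \<or> {h x, h y} \<in> E'"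
  shows "connected_graph V' E'"
proof -
  have "(h u, h w) \<in> {(x, y). {x, y} \<in> E'}\<^sup>*" if "(u, w) \<in> {(x, y). {x, y} \<in> E}\<^sup>*" for u w
    using that
  proof induction
    case (step y z)
    then have "h y = h z \<or> {h y, h z} \<in> E'" using h(2) by blast
    with step.IH show ?case by (auto intro: rtrancl_into_rtrancl)
  qed auto
  note path = this
  have "(u, w) \<in> {(x, y). {x, y} \<in> E'}\<^sup>*" if "u \<in> V'" "w \<in> V'" for u w
  proof -
    have "(u, w) \<in> {(x, y). {x, y} \<in> E}\<^sup>*"
      using con V'(1) that by (auto simp: connected_graph_def)
    then have "(h u, h w) \<in> {(x, y). {x, y} \<in> E'}\<^sup>*" by (rule path)
    then show ?thesis by (simp only: h(1) that)
  qed
  with simple V'(2) show ?thesis by (simp add: connected_graph_def)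
qed

lemma connected_remove_leaf:
  assumes con: "connected_graph V E" and j: "j \<in> V" "j \<noteq> i" and leaf: "\<And>e. e \<in> E \<Longrightarrow> i \<in> e \<Longrightarrow> e = {i, j}"
  shows "connected_graph (V - {i}) {e \<in> E. i \<notin> e}"
proof (rule connected_graph_map[OF con, where h = "\<lambda>x. if x = i then j else x"])
  show "simple_graph (V - {i}) {e \<in> E. i \<notin> e}"
    using con by (auto simp: connected_graph_def simple_graph_def)
  fix x y assume xy: "{x, y} \<in> E"
  show "(if x = i then j else x) = (if y = i then j else y) \<or>
      {if x = i then j else x, if y = i then j else y} \<in> {e \<in> E. i \<notin> e}"
  proof (cases "i \<in> {x, y}")
    case True
    then have "{x, y} = {i, j}" by (rule leaf[OF xy])
    then show ?thesis using j(2) by (auto simp: doubleton_eq_iff)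
  next
    case False
    then have "x \<noteq> i" "y \<noteq> i" by auto
    then show ?thesis using xy by simp
  qed
qed (use j in auto)

lemma connected_has_nbr:
  assumes con: "connected_graph V E" and v: "v \<in> V" "V \<noteq> {v}"
  shows "nbrs E v \<noteq> {}"
proof -
  obtain u where "u \<in> V" "u \<noteq> v" using v by blast
  then have "(v, u) \<in> {(x, y). {x, y} \<in> E}\<^sup>*" using con v by (simp add: connected_graph_def)
  then show ?thesis using \<open>u \<noteq> v\<close>
    by (cases rule: converse_rtranclE) (simp_all add: nbrs_def insert_commute, blast)
qed

text \<open>Sending \<open>v\<close> to one neighbour \<open>z\<close> is a retraction: an edge from
  \<open>v\<close> to \<open>y\<close> becomes the new edge from \<open>z\<close> to
  \<open>y\<close>, or collapses for \<open>y = z\<close>.\<close>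

lemma connected_eliminate:
  assumes con: "connected_graph V E" and v: "v \<in> V" "V \<noteq> {v}"
  shows "connected_graph (V - {v}) (elim_edges E v)"
proof -
  have G: "simple_graph V E" using con by (simp add: connected_graph_def)
  have NV: "nbrs E v \<subseteq> V" "v \<notin> nbrs E v"
    using simple_graphD[OF G] simple_graphD[OF G, of v v] by (auto simp: nbrs_def)
  obtain z where z: "z \<in> nbrs E v" using connected_has_nbr[OF assms] by blast
  show ?thesis
  proof (rule connected_graph_map[OF con, where h = "\<lambda>x. if x = v then z else x"])
    show "simple_graph (V - {v}) (elim_edges E v)"
      using G NV unfolding simple_graph_def elim_edges_def by auto
    fix x y assume xy: "{x, y} \<in> E"
    have pair: "{z, u} \<in> elim_edges E v" "{u, z} \<in> elim_edges E v" if "u \<in> nbrs E v" "u \<noteq> z" for u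
      using z that by (auto simp: elim_edges_def)
    have "x \<noteq> y" using simple_graphD[OF G xy] by blast
    then consider "x = v" "y \<noteq> v" | "y = v" "x \<noteq> v" | "x \<noteq> v" "y \<noteq> v" by blast
    then show "(if x = v then z else x) = (if y = v then z else y) \<or>
        {if x = v then z else x, if y = v then z else y} \<in> elim_edges E v"
    proof cases
      case 1
      then have "y \<in> nbrs E v" using xy by (simp add: nbrs_def insert_commute)
      then show ?thesis using 1 pair[of y] by auto
    next
      case 2
      then have "x \<in> nbrs E v" using xy by (simp add: nbrs_def)
      then show ?thesis using 2 pair[of x] by auto
    next
      case 3
      then show ?thesis using xy by (simp add: elim_edges_def)
    qed
  qed (use v in auto)
qed

text \<open>A vertex of maximal rank is nobody's parent, so its only edge goes to its own
  parent.\<close>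

lemma tree_leaf:
  assumes T: "tree_graph I F" and i0: "I \<noteq> {r}" "r \<in> I"
  obtains i j where "i \<in> I" "j \<in> I" "j \<noteq> i" "\<And>e. e \<in> F \<Longrightarrow> i \<in> e \<Longrightarrow> e = {i, j}"
proof -
  obtain f where f: "f \<in> (I - {r}) \<rightarrow>\<^sub>E I" "rooted (I - {r}) r f" "F = (\<lambda>u. {u, f u}) ` (I - {r})"
    using tree_parent_map[OF T i0(2)] by blast
  obtain d :: "'a \<Rightarrow> nat" where d: "\<And>u. u \<in> I - {r} \<Longrightarrow> d (f u) < d u"
    using reaches_rank[OF f(2)] by blast
  have fin: "finite I" using T by (simp add: tree_graph_def connected_graph_def simple_graph_def)
  have "I - {r} \<noteq> {}" using i0 by blast
  then have "d ` (I - {r}) \<noteq> {}" by blast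
  moreover have "finite (d ` (I - {r}))" using fin by simp
  ultimately have "Max (d ` (I - {r})) \<in> d ` (I - {r})" by (intro Max_in)
  then obtain i where i: "i \<in> I - {r}" "Max (d ` (I - {r})) = d i" by blast
  have i_max: "d u \<le> d i" if "u \<in> I - {r}" for u
    using fin that by (subst i(2)[symmetric], intro Max_ge) simp_all
  show thesis
  proof (rule that)
    show "i \<in> I" using i(1) by simp
    show "f i \<in> I" using f(1) i(1) by (rule PiE_mem)
    show "f i \<noteq> i" using d[OF i(1)] by auto
    fix e assume e: "e \<in> F" "i \<in> e"
    then obtain u where u: "u \<in> I - {r}" "e = {u, f u}" unfolding f(3) by blast
    have "i \<noteq> f u" using i_max[OF u(1)] d[OF u(1)] by auto
    then show "e = {i, f i}" using u(2) e(2) by auto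
  qed
qed

text \<open>Whatever bag \<open>i\<close> covers, bag \<open>j\<close> covers too. If
  \<open>v\<close> is in \<open>B i\<close>, it is in \<open>B j\<close>, so \<open>i\<close> is
  also a leaf of the subtree of \<open>v\<close>.\<close>

lemma tree_decomposition_remove_leaf:
  assumes dec: "tree_decomposition V E I F B"
    and ij: "i \<in> I" "j \<in> I" "j \<noteq> i" "\<And>e. e \<in> F \<Longrightarrow> i \<in> e \<Longrightarrow> e = {i, j}" and sub: "B i \<subseteq> B j"
  shows "tree_decomposition V E (I - {i}) {e \<in> F. i \<notin> e} B"
  unfolding tree_decomposition_def
proof (intro conjI ballI)
  have T: "tree_graph I F" and U: "(\<Union>i\<in>I. B i) = V" and cov: "\<And>e. e \<in> E \<Longrightarrow> \<exists>i\<in>I. e \<subseteq> B i"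
    and con: "\<And>v. v \<in> V \<Longrightarrow> connected_graph {i\<in>I. v \<in> B i} {f\<in>F. f \<subseteq> {i\<in>I. v \<in> B i}}"
    using dec by (auto simp: tree_decomposition_def)
  show "tree_graph (I - {i}) {e \<in> F. i \<notin> e}"
    using T connected_remove_leaf[of I F j i] ij unfolding tree_graph_def graph_cycle_def by blast
  show "(\<Union>i\<in>I - {i}. B i) = V" using U ij sub by blast
  show "\<exists>i'\<in>I - {i}. e \<subseteq> B i'" if "e \<in> E" for e using cov[OF that] ij sub by blast
  fix v assume v: "v \<in> V"
  let ?S = "{i\<in>I. v \<in> B i}"
  show "connected_graph {i' \<in> I - {i}. v \<in> B i'} {f \<in> {e \<in> F. i \<notin> e}. f \<subseteq> {i' \<in> I - {i}. v \<in> B i'}}"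
  proof (cases "v \<in> B i")
    case True
    have "connected_graph (?S - {i}) {e \<in> {f\<in>F. f \<subseteq> ?S}. i \<notin> e}"
      by (rule connected_remove_leaf[OF con[OF v], of j]) (use True ij sub in auto)
    moreover have "?S - {i} = {i' \<in> I - {i}. v \<in> B i'}"
      "{e \<in> {f\<in>F. f \<subseteq> ?S}. i \<notin> e} = {f \<in> {e \<in> F. i \<notin> e}. f \<subseteq> {i' \<in> I - {i}. v \<in> B i'}}"
      by auto
    ultimately show ?thesis by simp
  next
    case False
    then have "?S = {i' \<in> I - {i}. v \<in> B i'}"
      "{f\<in>F. f \<subseteq> ?S} = {f \<in> {e \<in> F. i \<notin> e}. f \<subseteq> {i' \<in> I - {i}. v \<in> B i'}}"
      by auto
    with con[OF v] show ?thesis by simp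
  qed
qed

text \<open>The subtree of \<open>v\<close> is connected and contains \<open>i\<close> but not
  \<open>j\<close>, the only node next to \<open>i\<close>. Hence it is \<open>{i}\<close>, and
  every edge at \<open>v\<close> must be covered by \<open>B i\<close>.\<close>

lemma tree_decomposition_leaf_vertex:
  assumes G: "simple_graph V E" and dec: "tree_decomposition V E I F B"
    and ij: "i \<in> I" "j \<in> I" "j \<noteq> i" "\<And>e. e \<in> F \<Longrightarrow> i \<in> e \<Longrightarrow> e = {i, j}"
    and v: "v \<in> B i" "v \<notin> B j"
  shows "v \<in> V" "insert v (nbrs E v) \<subseteq> B i"
proof -
  have U: "(\<Union>i\<in>I. B i) = V" and cov: "\<And>e. e \<in> E \<Longrightarrow> \<exists>i\<in>I. e \<subseteq> B i"
    and con: "\<And>v. v \<in> V \<Longrightarrow> connected_graph {i\<in>I. v \<in> B i} {f\<in>F. f \<subseteq> {i\<in>I. v \<in> B i}}"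
    using dec by (auto simp: tree_decomposition_def)
  show vV: "v \<in> V" using U ij v by blast
  let ?S = "{i\<in>I. v \<in> B i}"
  have only: "i' = i" if i': "i' \<in> I" "v \<in> B i'" for i'
  proof (rule ccontr)
    assume "i' \<noteq> i"
    have "(i, i') \<in> {(x, y). {x, y} \<in> {f\<in>F. f \<subseteq> ?S}}\<^sup>*"
      using con[OF vV] i' ij v by (simp add: connected_graph_def)
    then obtain y where "{i, y} \<in> F" "{i, y} \<subseteq> ?S"
      using \<open>i' \<noteq> i\<close> by (cases rule: converse_rtranclE) auto
    then have "j \<in> ?S" using ij(4)[of "{i, y}"] by auto
    with v show False by simp
  qed
  have "u \<in> B i" if "u \<in> nbrs E v" for u
  proof -
    have "{u, v} \<in> E" using that by (simp add: nbrs_def)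
    then obtain i' where "i' \<in> I" "{u, v} \<subseteq> B i'" using cov by blast
    with only show ?thesis by auto
  qed
  with v show "insert v (nbrs E v) \<subseteq> B i" by auto
qed

text \<open>The new edges lie inside \<open>B i\<close>, so the same tree serves and no bag
  grows.\<close>

lemma tree_decomposition_eliminate:
  assumes dec: "tree_decomposition V E I F B" and i: "i \<in> I" "insert v (nbrs E v) \<subseteq> B i"
    and v: "v \<notin> nbrs E v"
  shows "tree_decomposition (V - {v}) (elim_edges E v) I F (\<lambda>i. B i - {v})"
  unfolding tree_decomposition_def
proof (intro conjI ballI)
  show "tree_graph I F" using dec by (simp add: tree_decomposition_def)
  show "(\<Union>i\<in>I. B i - {v}) = V - {v}" using dec by (auto simp: tree_decomposition_def)
  fix e assume "e \<in> elim_edges E v"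
  then consider "e \<in> E" "v \<notin> e" | "e \<subseteq> nbrs E v" by (auto simp: elim_edges_def)
  then show "\<exists>i\<in>I. e \<subseteq> B i - {v}"
  proof cases
    case 1
    then obtain j where "j \<in> I" "e \<subseteq> B j" using dec unfolding tree_decomposition_def by blast
    with 1 show ?thesis by blast
  next
    case 2
    then show ?thesis using i v by blast
  qed
next
  fix w assume w: "w \<in> V - {v}"
  then have "{i \<in> I. w \<in> B i - {v}} = {i \<in> I. w \<in> B i}" by auto
  then show "connected_graph {i \<in> I. w \<in> B i - {v}} {f \<in> F. f \<subseteq> {i \<in> I. w \<in> B i - {v}}}"
    using dec w by (simp add: tree_decomposition_def)
qed

lemma treewidth_decomposition:
  assumes con: "connected_graph V E"
  obtains I :: "nat set" and F B where "tree_decomposition V E I F B"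
    "\<And>i. i \<in> I \<Longrightarrow> card (B i) \<le> treewidth V E + 1"
proof -
  have triv: "connected_graph {0::nat} {}" by (simp add: connected_graph_def simple_graph_def)
  have "tree_decomposition V E {0::nat} {} (\<lambda>_. V)"
    unfolding tree_decomposition_def
  proof (intro conjI ballI)
    have "\<not> graph_cycle {} p" for p :: "nat list"
    proof
      assume "graph_cycle {} p"
      then have "3 \<le> length p" "\<forall>i<length p. False" by (simp_all add: graph_cycle_def)
      then show False by (metis le_zero_eq not_gr_zero zero_neq_numeral)
    qed
    with triv show "tree_graph {0::nat} {}" by (simp add: tree_graph_def)
    fix e assume "e \<in> E"
    then show "\<exists>i\<in>{0}. e \<subseteq> V" using con by (auto simp: connected_graph_def simple_graph_def)
  next
    fix v assume "v \<in> V"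
    then have "{i \<in> {0::nat}. v \<in> V} = {0}" by auto
    then show "connected_graph {i \<in> {0::nat}. v \<in> V} {f \<in> {}. f \<subseteq> {i \<in> {0}. v \<in> V}}"
      using triv by simp
  qed simp
  then have "\<exists>w. \<exists>(I :: nat set) F B. tree_decomposition V E I F B \<and> decomposition_width I B = w"
    by blast
  then have "\<exists>(I :: nat set) F B. tree_decomposition V E I F B \<and> decomposition_width I B = treewidth V E"
    unfolding treewidth_def by (rule LeastI_ex)
  then obtain I :: "nat set" and F B where
    dec: "tree_decomposition V E I F B" and w: "decomposition_width I B = treewidth V E" by blast
  have "finite I"
    using dec by (simp add: tree_decomposition_def tree_graph_def connected_graph_def simple_graph_def)
  then have "card (B i) \<le> treewidth V E + 1" if "i \<in> I" for i
  proof -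
    have "card (B i) \<le> Max ((\<lambda>i. card (B i)) ` I)"
      using \<open>finite I\<close> that by (intro Max_ge) auto
    \<comment> \<open>Truncated subtraction does no harm: \<open>m - 1 = w\<close> gives
      \<open>m \<le> w + 1\<close> also for \<open>m = 0\<close>.\<close>
    with w show ?thesis unfolding decomposition_width_def by linarith
  qed
  then show thesis using that[OF dec] by blast
qed

section \<open>Negative powers of the spanning tree polynomial\<close>

lemma spanning_tree_poly_cong:
  assumes "\<And>e. e \<in> E \<Longrightarrow> x e = y e"
  shows "spanning_tree_poly V E x = spanning_tree_poly V E y"
  unfolding spanning_tree_poly_def
proof (rule sum.cong[OF refl])
  fix T assume "T \<in> spanning_trees V E"
  then have "T \<subseteq> E" by (simp add: spanning_trees_def)
  then show "prod x T = prod y T" by (intro prod.cong refl assms) blast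
qed

lemma star_mesh_positive_orthant:
  assumes x: "x \<in> positive_orthant E" and s: "star_weight E v x > 0"
  shows "restrict (star_mesh E v x) (elim_edges E v) \<in> positive_orthant (elim_edges E v)"
proof -
  have pos: "x e > 0" if "e \<in> E" for e using x that by (auto simp: positive_orthant_def)
  have "star_mesh E v x e > 0" if e: "e \<in> elim_edges E v" for e
  proof -
    have p: "(\<Prod>u\<in>e. x {u, v}) / star_weight E v x > 0" if "e \<subseteq> nbrs E v"
      using that s pos by (intro divide_pos_pos prod_pos) (auto simp: nbrs_def)
    from e show ?thesis unfolding star_mesh_def elim_edges_def
      using p pos by (auto intro: add_pos_pos)
  qed
  then show ?thesis by (simp add: positive_orthant_def)
qed

text \<open>Induction on the number of vertices plus nodes: a leaf bag contained in its neighbour is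
  dropped; otherwise it owns a vertex that can be eliminated. Positivity comes along, both factors
  of the star-mesh identity being positive.\<close>

lemma spanning_tree_poly_mixture:
  assumes "connected_graph V E" "tree_decomposition V E I F B"
    and "\<And>i. i \<in> I \<Longrightarrow> card (B i) \<le> k + 1" and \<beta>: "\<beta> > (real k - 1) / 2"
  shows "(\<forall>x\<in>positive_orthant E. spanning_tree_poly V E x > 0) \<and>
    mixture (positive_orthant E) (exp_gens E) (\<lambda>x. spanning_tree_poly V E x powr (- \<beta>))"
  using assms(1-3)
proof (induction "card V + card I" arbitrary: V E I F B rule: less_induct)
  case less
  have G: "simple_graph V E" and finV: "finite V" and V: "V \<noteq> {}"
    using less.prems(1) by (simp_all add: connected_graph_def simple_graph_def)
  have T: "tree_graph I F" using less.prems(2) by (simp add: tree_decomposition_def)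
  then have finI: "finite I" and I: "I \<noteq> {}" by (simp_all add: tree_graph_def connected_graph_def simple_graph_def)
  have "(\<Union>i\<in>I. B i) = V" using less.prems(2) by (simp add: tree_decomposition_def)
  then have BV: "B i \<subseteq> V" if "i \<in> I" for i using that by blast
  obtain r where r: "r \<in> V" using V by blast
  obtain i0 where i0: "i0 \<in> I" using I by blast
  show ?case
  proof (cases "V = {r}")
    case True
    have E: "E = {}"
    proof (rule ccontr)
      assume "E \<noteq> {}"
      then obtain e where "e \<subseteq> {r}" "card e = 2" using G True by (auto simp: simple_graph_def)
      then show False using card_mono[of "{r}" e] by simp
    qed
    have one: "spanning_tree_poly V E x = 1" for x
      using spanning_tree_poly_arbo[OF G r] True by (simp add: arbo_def rooted_def)
    have "euclidean E (\<lambda>e. 0)" unfolding euclidean_def euclidean_on_def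
      by (intro allI impI exI[of _ 0]) simp
    then have "(\<lambda>x. exp (- (\<Sum>e\<in>E. 0 * x e))) \<in> exp_gens E"
      unfolding exp_gens_def by (intro CollectI exI[of _ "\<lambda>e. 0"]) simp
    from mixture.gen[OF this] show ?thesis by (simp add: one)
  next
    case V2: False
    have ?thesis if v: "v \<in> V" and i: "i \<in> I" "insert v (nbrs E v) \<subseteq> B i" for v i
    proof -
      \<comment> \<open>Points of the orthant are extensional, so \<open>?\<phi>\<close> restricts
        the new weights to the new edges; the polynomial reads no other values.\<close>
      let ?N = "nbrs E v" and ?E = "elim_edges E v" and ?\<phi> = "\<lambda>x. restrict (star_mesh E v x) (elim_edges E v)"
      have vV: "V \<noteq> {v}" using V2 r by auto
      have N: "?N \<noteq> {}" by (rule connected_has_nbr[OF less.prems(1) v vV])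
      have vN: "v \<notin> ?N" using simple_graphD[OF G, of v v] by (auto simp: nbrs_def)
      have finB: "finite (B i)" by (rule finite_subset[OF BV[OF i(1)] finV])
      have finN: "finite ?N" by (rule finite_subset[OF _ finB]) (use i(2) in simp)
      have "card (insert v ?N) \<le> k + 1"
        using card_mono[OF finB i(2)] less.prems(3)[OF i(1)] by simp
      then have "real (card ?N) \<le> real k" using finN vN by simp
      then have \<beta>N: "(real (card ?N) - 1) / 2 < \<beta>"
        by (intro le_less_trans[OF divide_right_mono[OF diff_right_mono] \<beta>]) simp_all
      have con': "connected_graph (V - {v}) ?E" by (rule connected_eliminate[OF less.prems(1) v vV])
      have IH: "(\<forall>x\<in>positive_orthant ?E. spanning_tree_poly (V - {v}) ?E x > 0) \<and>
        mixture (positive_orthant ?E) (exp_gens ?E) (\<lambda>x. spanning_tree_poly (V - {v}) ?E x powr (- \<beta>))"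
      proof (rule less.hyps[OF _ con'])
        show "card (V - {v}) + card I < card V + card I" 
          using card_Diff1_less[OF finV v] by (simp only: add_less_cancel_right)
        show "tree_decomposition (V - {v}) ?E I F (\<lambda>i. B i - {v})"
          by (rule tree_decomposition_eliminate[OF less.prems(2) i vN])
        fix i assume "i \<in> I"
        then show "card (B i - {v}) \<le> k + 1"
          using less.prems(3) BV finV by (meson card_Diff1_le le_trans)
      qed
      have s: "star_weight E v x > 0" if "x \<in> positive_orthant E" for x
        unfolding star_weight_def using that N finN
        by (intro sum_pos) (auto simp: positive_orthant_def nbrs_def)
      have \<phi>: "?\<phi> x \<in> positive_orthant ?E" if "x \<in> positive_orthant E" for x
        using that s by (intro star_mesh_positive_orthant)
      have eq: "spanning_tree_poly V E x = star_weight E v x * spanning_tree_poly (V - {v}) ?E (?\<phi> x)"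
        if "x \<in> positive_orthant E" for x
      proof -
        have "spanning_tree_poly (V - {v}) ?E (star_mesh E v x) = spanning_tree_poly (V - {v}) ?E (?\<phi> x)"
          by (rule spanning_tree_poly_cong) simp
        then show ?thesis using spanning_tree_poly_star_mesh[OF G v vV] s[OF that] by simp
      qed
      have "mixture (positive_orthant E) (exp_gens E)
        (\<lambda>x. star_weight E v x powr (- \<beta>) * spanning_tree_poly (V - {v}) ?E (?\<phi> x) powr (- \<beta>))"
      proof (rule mixture_subst[where f = "\<lambda>x. spanning_tree_poly (V - {v}) ?E x powr (- \<beta>)"
            and D = "positive_orthant ?E" and G = "exp_gens ?E" and \<phi> = ?\<phi>])
        fix g assume "g \<in> exp_gens ?E"
        then obtain a where a: "euclidean ?E a" "g = (\<lambda>x. exp (- (\<Sum>e\<in>?E. a e * x e)))"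
          by (auto simp: exp_gens_def)
        have "g (?\<phi> x) = exp (- (\<Sum>e\<in>?E. a e * star_mesh E v x e))" for x
          unfolding a by simp
        then show "mixture (positive_orthant E) (exp_gens E) (\<lambda>x. star_weight E v x powr (- \<beta>) * g (?\<phi> x))"
          using mixture_eliminate[OF G N \<beta>N a(1)] by simp
      qed (use IH \<phi> in auto)
      then have "mixture (positive_orthant E) (exp_gens E) (\<lambda>x. spanning_tree_poly V E x powr (- \<beta>))"
      proof (rule mixture_cong)
        fix x assume x: "x \<in> positive_orthant E"
        show "spanning_tree_poly V E x powr (- \<beta>) =
            star_weight E v x powr (- \<beta>) * spanning_tree_poly (V - {v}) ?E (?\<phi> x) powr (- \<beta>)"
          unfolding eq[OF x] by (rule powr_mult)
      qed
      moreover have "spanning_tree_poly V E x > 0" if "x \<in> positive_orthant E" for x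
        unfolding eq[OF that] by (intro mult_pos_pos s that bspec[OF conjunct1[OF IH]] \<phi>)
      ultimately show ?thesis by blast
    qed
    note eliminate = this
    show ?thesis
    proof (cases "I = {i0}")
      case True
      \<comment> \<open>With a single bag, any vertex can be eliminated.\<close>
      then have "B i0 = V" using less.prems(2) by (simp add: tree_decomposition_def)
      moreover have "nbrs E r \<subseteq> V" using simple_graphD[OF G] unfolding nbrs_def by blast
      ultimately show ?thesis using eliminate[OF r i0] r by simp
    next
      case False
      obtain i j where ij: "i \<in> I" "j \<in> I" "j \<noteq> i" "\<And>e. e \<in> F \<Longrightarrow> i \<in> e \<Longrightarrow> e = {i, j}"
        using tree_leaf[OF T False i0] by blast
      show ?thesis
      proof (cases "B i \<subseteq> B j")
        case True
        show ?thesis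
        proof (rule less.hyps[OF _ less.prems(1)])
          show "card V + card (I - {i}) < card V + card I"
            using card_Diff1_less[OF finI ij(1)] by (simp only: add_less_cancel_left)
          show "tree_decomposition V E (I - {i}) {e \<in> F. i \<notin> e} B"
            by (rule tree_decomposition_remove_leaf[OF less.prems(2) ij True])
        qed (use less.prems(3) in auto)
      next
        case False
        then obtain v where v: "v \<in> B i" "v \<notin> B j" by blast
        note leaf = tree_decomposition_leaf_vertex[where i = i and j = j and v = v, OF G less.prems(2) ij v]
        show ?thesis by (rule eliminate[OF leaf(1) ij(1) leaf(2)])
      qed
    qed
  qed
qed

theorem theorem4p7:
  fixes V :: "'a set" and E :: "'a set set" and k :: nat and \<beta> :: real
  assumes "connected_graph V E"
    and "treewidth V E \<le> k"
    and "\<beta> > 0"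
    and "\<beta> > (real k - 1) / 2"
  shows "completely_monotone E (\<lambda>x. spanning_tree_poly V E x powr (- \<beta>))"
proof -
  obtain I :: "nat set" and F B where dec: "tree_decomposition V E I F B"
    "\<And>i. i \<in> I \<Longrightarrow> card (B i) \<le> treewidth V E + 1"
    using treewidth_decomposition[OF assms(1)] by blast
  have "card (B i) \<le> k + 1" if "i \<in> I" for i using dec(2)[OF that] assms(2) by simp
  from spanning_tree_poly_mixture[OF assms(1) dec(1) this assms(4)]
  have pos: "\<And>x. x \<in> positive_orthant E \<Longrightarrow> spanning_tree_poly V E x > 0"
    and mix: "mixture (positive_orthant E) (exp_gens E) (\<lambda>x. spanning_tree_poly V E x powr (- \<beta>))"
    by auto
  have E: "\<And>e. e \<in> E \<Longrightarrow> card e = 2" "E \<subseteq> Pow V" "finite V"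
    using assms(1) by (auto simp: connected_graph_def simple_graph_def)
  then have finE: "finite E" by (auto intro: finite_subset)
  show ?thesis
  proof (rule completely_monotoneI_mixed_diff)
    \<comment> \<open>Smoothness is read off from the closed form; the mixture only supplies
      signs.\<close>
    have "elementary E (\<lambda>x. spanning_tree_poly V E x)"
      unfolding spanning_tree_poly_def
      by (intro elementary_sum elementary_prod elementary.coord) (auto simp: spanning_trees_def)
    then show "smooth_on_orthant E (\<lambda>x. spanning_tree_poly V E x powr (- \<beta>))"
      using pos by (intro elementary_smooth elementary.powr) auto
    fix l x assume l: "steps E l" and x: "x \<in> positive_orthant E"
    show "0 \<le> mixed_diff l (\<lambda>x. spanning_tree_poly V E x powr (- \<beta>)) x"
    proof (rule mixture_mixed_diff_nonneg[OF mix l x])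
      fix g assume "g \<in> exp_gens E"
      then obtain a where a: "euclidean E a" "g = (\<lambda>x. exp (- (\<Sum>e\<in>E. a e * x e)))"
        by (auto simp: exp_gens_def)
      show "0 \<le> mixed_diff l g x"
        using mixed_diff_exp_nonneg[OF finE euclidean_nonneg[OF a(1) _ E(1)] l, where c = 1] a(2) by simp
    qed
  qed
qed

end
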